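(* Let $n\ge 3$, $\alpha\in(0,1)$, and let $\mathbf D_n=(Z_1,\dots,Z_n)$, $Z_i=(X_i,Y_i)$, be i.i.d. training data in $\mathcal X\times\mathcal Y$, with $(X_{\rm test},Y_{\rm test})$ an independent test point with the same distribution. Suppose that the training algorithm $T$ and the model $\{\mu_\beta\}_{\beta\in\mathbb R^p}$ satisfy the following three assumptions (all notation is as in the context): (A1) (uniform stability) for every sample size $k\ge 2$ and every $i\in\{1,\dots,k\}$, $$\sup_{z_1,\dots,z_k\in\mathcal X\times\mathcal Y}\big\|\mu_{T(z_1,\dots,z_{i-1},z_{i+1},\dots,z_k)}-\mu_{T(z_1,\dots,z_k)}\big\|_\infty\le \frac{c_k}{2};$$ (A2) (bi-Lipschitz parametrization) there are constants $\kappa_1>0$ and $\kappa_2<\infty$ such that $\kappa_1\|\beta-\beta'\|_\infty\le\|\mu_\beta-\mu_{\beta'}\|_\infty\le\kappa_2\|\beta-\beta'\|_\infty$ for all $\beta,\beta'\in\mathbb R^p$; (A3) (bounded density) for every $k$, the distribution function $F_k$ has a density $F_k'$ satisfying $F_k'<L_k$. Let $P_e^{\mathrm{J+}}(\mathbf D_n)=\mathbb P\big(Y_{\rm test}\notin\hat C^{\mathrm{J+}}_\alpha(X_{\rm test})\,\big|\,\mathbf D_n\big)$ be the training-conditional miscoverage rate of the jackknife+ interval. Then for all $\epsilon,\delta>0$, $$\mathbb P\left(P_e^{\mathrm{J+}}(\mathbf D_n)>\alpha+\sqrt{\frac{\log(2/\delta)}{2n}}+2L_{n-1}\,\kappa_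2\,c_{n-1}\left(\frac1{\kappa_1}+\sqrt{\frac{n}{2\kappa_1^2}\log\frac{2p}{\epsilon}}\right)\right)\le\epsilon+\delta.$$
   Context: $\mathcal X$ is a measurable space and $\mathcal Y\subseteq\mathbb R$ is Borel. For each $\beta\in\mathbb R^p$ ($p\ge1$), $\mu_\beta:\mathcal X\to\mathbb R$ is a bounded measurable predictor function; $\|\mu\|_\infty=\sup_{x\in\mathcal X}|\mu(x)|$ for functions, and $\|\cdot\|_\infty$ is the max-norm on $\mathbb R^p$. A training algorithm is a measurable map $T:\bigcup_{k\ge1}(\mathcal X\times\mathcal Y)^k\to\mathbb R^p$; the fitted predictor on data $(z_1,\dots,z_k)$ is $\mu_{T(z_1,\dots,z_k)}$. The constants $c_k>0$ and $L_k$ are finite and may depend on the sample size $k$. Write $\overline\beta_k=\mathbb E\,T(Z_1,\dots,Z_k)$ (coordinatewise expectation, $Z_i$ i.i.d. from the data distribution), and $$F_k(t)=\mathbb P\big(|Y-\mu_{\overline\beta_k}(X)|\le t\big),$$ where $(X,Y)$ has the data distribution. Jackknife+: let $\hat\beta_{-i}=T(Z_1,\dots,Z_{i-1},Z_{i+1},\dots,Z_n)$ and $R_i=|Y_i-\mu_{\hat\beta_{-i}}(X_i)|$. For a finite multiset $A$ of $n$ real numbers, let $\hat q^+_\alpha(A)$ be the $\lceil(1-\alpha)(n+1)\rceil$-th smallest element of $A$ and $\hat q^-_\alpha(A)$ the $\lfloor\alpha(n+1)\rfloor$-th smallest element of $A$, with the conventions $\hat q^+_\alpha(A)=+\infty$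 and $\hat q^-_\alpha(A)=-\infty$ if $\alpha<1/(n+1)$. The jackknife+ prediction interval is $$\hat C^{\mathrm{J+}}_\alpha(x)=\Big[\hat q^-_\alpha\big(\{\mu_{\hat\beta_{-i}}(x)-R_i\}_{i=1}^n\big),\ \hat q^+_\alpha\big(\{\mu_{\hat\beta_{-i}}(x)+R_i\}_{i=1}^n\big)\Big].$$ A square root in the bound can have a negative argument only when $\epsilon+\delta\ge1$, in which case the inequality is regarded as trivially true. *)

theory Defs
  imports "HOL-Probability.Probability"
begin

text \<open>
  Data sets are lists over \<open>'x \<times> real\<close>, so that a training algorithm, whose domain is the
  disjoint union over \<open>k \<ge> 1\<close> of the \<open>k\<close>-fold powers of \<open>\<X> \<times> \<Y>\<close>, is a single function on lists.
  Positions are counted from 0. Parameters live in \<open>real ^ 'p\<close>; the library's \<^const>\<open>infnorm\<close>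
  is the max-norm there.
\<close>

definition data_space :: "'x measure \<Rightarrow> real set \<Rightarrow> ('x \<times> real) measure" where
  "data_space SX Y = SX \<Otimes>\<^sub>M restrict_space borel Y"

definition sup_norm :: "'x measure \<Rightarrow> ('x \<Rightarrow> real) \<Rightarrow> real" where
  "sup_norm SX f = (SUP x\<in>space SX. \<bar>f x\<bar>)"

definition delete_nth :: "nat \<Rightarrow> 'a list \<Rightarrow> 'a list" where
  "delete_nth i zs = take i zs @ drop (Suc i) zs"

text \<open>
  The \<open>\<sigma>\<close>-algebra on the disjoint union of the powers makes a map measurable iff its restriction
  to each power is.
\<close>

definition training_algorithm ::
    "'x measure \<Rightarrow> real set \<Rightarrow> (('x \<times> real) list \<Rightarrow> real ^ 'p) \<Rightarrow> bool" where
  "training_algorithm SX Y T \<longleftrightarrow>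
     (\<forall>k\<ge>1. (\<lambda>z. T (map z [0..<k])) \<in> borel_measurable (\<Pi>\<^sub>M i\<in>{..<k}. data_space SX Y))"

definition mean_param ::
    "('x \<times> real) measure \<Rightarrow> (('x \<times> real) list \<Rightarrow> real ^ 'p) \<Rightarrow> nat \<Rightarrow> real ^ 'p" where
  "mean_param P T k = (\<chi> j. \<integral>z. T (map z [0..<k]) $ j \<partial>(\<Pi>\<^sub>M i\<in>{..<k}. P))"

definition resid_cdf ::
    "('x \<times> real) measure \<Rightarrow> (real ^ 'p \<Rightarrow> 'x \<Rightarrow> real) \<Rightarrow> (('x \<times> real) list \<Rightarrow> real ^ 'p)
      \<Rightarrow> nat \<Rightarrow> real \<Rightarrow> real" where
  "resid_cdf P \<mu> T k t = measure P {(x, y) \<in> space P. \<bar>y - \<mu> (mean_param P T k) x\<bar> \<le> t}"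

definition has_density :: "(real \<Rightarrow> real) \<Rightarrow> (real \<Rightarrow> real) \<Rightarrow> bool" where
  "has_density F f \<longleftrightarrow> f \<in> borel_measurable borel \<and> (\<forall>s. 0 \<le> f s) \<and>
     (\<forall>t. ennreal (F t) = (\<integral>\<^sup>+s\<in>{..t}. ennreal (f s) \<partial>lborel))"

text \<open>The \<open>k\<close>-th smallest element, counted from 1 and with multiplicity.\<close>

definition kth_smallest :: "nat \<Rightarrow> real multiset \<Rightarrow> real" where
  "kth_smallest k A = sorted_list_of_multiset A ! (k - 1)"

definition q_plus :: "real \<Rightarrow> real multiset \<Rightarrow> ereal" where
  "q_plus \<alpha> A =
     (if \<alpha> < 1 / (real (size A) + 1) then \<infinity>
      else ereal (kth_smallest (nat \<lceil>(1 - \<alpha>) * (real (size A) + 1)\<rceil>) A))"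

definition q_minus :: "real \<Rightarrow> real multiset \<Rightarrow> ereal" where
  "q_minus \<alpha> A =
     (if \<alpha> < 1 / (real (size A) + 1) then - \<infinity>
      else ereal (kth_smallest (nat \<lfloor>\<alpha> * (real (size A) + 1)\<rfloor>) A))"

definition loo_resid ::
    "(real ^ 'p \<Rightarrow> 'x \<Rightarrow> real) \<Rightarrow> (('x \<times> real) list \<Rightarrow> real ^ 'p) \<Rightarrow> ('x \<times> real) list
      \<Rightarrow> nat \<Rightarrow> real" where
  "loo_resid \<mu> T zs i = \<bar>snd (zs ! i) - \<mu> (T (delete_nth i zs)) (fst (zs ! i))\<bar>"

definition jackknife_plus ::
    "(real ^ 'p \<Rightarrow> 'x \<Rightarrow> real) \<Rightarrow> (('x \<times> real) list \<Rightarrow> real ^ 'p) \<Rightarrow> real \<Rightarrow> ('x \<times> real) list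
      \<Rightarrow> 'x \<Rightarrow> real set" where
  "jackknife_plus \<mu> T \<alpha> zs x =
     {y. q_minus \<alpha> {# \<mu> (T (delete_nth i zs)) x - loo_resid \<mu> T zs i. i \<in># mset [0..<length zs] #}
           \<le> ereal y \<and>
         ereal y
           \<le> q_plus \<alpha> {# \<mu> (T (delete_nth i zs)) x + loo_resid \<mu> T zs i. i \<in># mset [0..<length zs] #}}"

definition cond_prob_given ::
    "'w measure \<Rightarrow> 'd measure \<Rightarrow> ('w \<Rightarrow> 'd) \<Rightarrow> 'w set \<Rightarrow> 'w \<Rightarrow> real" where
  "cond_prob_given M N D A = real_cond_exp M (vimage_algebra (space M) D N) (indicator A)"

definition jackknife_plus_miscoverage ::
    "'w measure \<Rightarrow> ('x \<times> real) measure \<Rightarrow> (real ^ 'p \<Rightarrow> 'x \<Rightarrow> real)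
      \<Rightarrow> (('x \<times> real) list \<Rightarrow> real ^ 'p) \<Rightarrow> real \<Rightarrow> nat \<Rightarrow> (nat \<Rightarrow> 'w \<Rightarrow> 'x \<times> real)
      \<Rightarrow> ('w \<Rightarrow> 'x \<times> real) \<Rightarrow> 'w \<Rightarrow> real" where
  "jackknife_plus_miscoverage M P \<mu> T \<alpha> n Z Ztest =
     cond_prob_given M (\<Pi>\<^sub>M i\<in>{..<n}. P) (\<lambda>\<omega>. \<lambda>i\<in>{..<n}. Z i \<omega>)
       {\<omega> \<in> space M. snd (Ztest \<omega>)
          \<notin> jackknife_plus \<mu> T \<alpha> (map (\<lambda>i. Z i \<omega>) [0..<n]) (fst (Ztest \<omega>))}"

end

theory Submission imports Defs begin

text \<open>
  Put \<open>m = n - 1\<close> and \<open>b = c\<^sub>m / \<kappa>\<^sub>1\<close>. Replacing one of \<open>m\<close> data points moves the fitted parameter by at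
  most \<open>b\<close>, so McDiarmid's inequality in each of the \<open>p\<close> coordinates puts the last leave-one-out
  parameter within \<open>b * sqrt (n / 2 * ln (2 * p / \<epsilon>))\<close> of its mean, outside an event of probability
  \<open>\<epsilon>\<close>. All leave-one-out parameters lie within \<open>b\<close> of each other, hence every leave-one-out predictor
  is within some \<open>\<Delta>\<close> of the deterministic predictor at the mean parameter. Let \<open>S\<^sub>i\<close> and \<open>S\<close> be the
  residuals of the training points and the test point for that deterministic predictor; they are
  i.i.d. with distribution function \<open>F\<close>. A miss of the jackknife+ interval forces
  \<open>S\<^sub>i < S + 2 * \<Delta>\<close> for at least \<open>(1 - \<alpha>) * n\<close> indices.

  Uniform convergence of the empirical distribution function is not needed: for
  \<open>u = 1 - \<alpha> - sqrt (ln (2 / \<delta>) / (2 * n))\<close>, Hoeffding's inequality for the indicators of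
  \<open>F S\<^sub>i < u\<close> shows that outside an event of probability \<open>\<delta>\<close> fewer than \<open>(1 - \<alpha>) * n\<close> of them
  hold. Then a miss forces \<open>S\<close> above \<open>v - 2 * \<Delta>\<close>, where \<open>v\<close> is the least \<open>S\<^sub>i\<close> with \<open>F S\<^sub>i \<ge> u\<close>,
  and the density bound gives the conditional probability at most \<open>1 - u + 2 * L * \<Delta>\<close>.
\<close>

section \<open>Bounded differences\<close>

text \<open>Overwriting the coordinates one after another by fixed reference values leads from every
  point to the same point, at a total cost of at most the sum of the \<open>c i\<close>.\<close>

lemma bounded_of_bounded_differences:
  fixes f :: "('i \<Rightarrow> 'a) \<Rightarrow> real" and M :: "'i \<Rightarrow> 'a measure"
  assumes "finite I" and nonempty: "\<And>i. i \<in> I \<Longrightarrow> space (M i) \<noteq> {}"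
    and diff: "\<And>x i y. x \<in> space (PiM I M) \<Longrightarrow> i \<in> I \<Longrightarrow> y \<in> space (M i) \<Longrightarrow>
      \<bar>f (x(i := y)) - f x\<bar> \<le> c i"
  shows "\<exists>B. \<forall>x\<in>space (PiM I M). \<bar>f x\<bar> \<le> B"
  using assms
proof (induction I arbitrary: f rule: finite_induct)
  case empty
  then show ?case by (auto simp: space_PiM)
next
  case (insert i I)
  obtain y0 where y0: "y0 \<in> space (M i)"
    using insert.prems(1)[of i] by auto
  have upd: "x(i := y) \<in> space (PiM (insert i I) M)"
    if "x \<in> space (PiM I M)" "y \<in> space (M i)" for x y
    using that by (auto simp: space_PiM PiE_def extensional_def)
  have "\<exists>B. \<forall>x\<in>space (PiM I M). \<bar>f (x(i := y0))\<bar> \<le> B"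
  proof (rule insert.IH)
    show "space (M j) \<noteq> {}" if "j \<in> I" for j
      using insert.prems(1) that by auto
    fix x j y assume *: "x \<in> space (PiM I M)" "j \<in> I" "y \<in> space (M j)"
    then have "j \<noteq> i" using insert.hyps by auto
    then have "(x(j := y))(i := y0) = (x(i := y0))(j := y)"
      by (rule fun_upd_twist)
    then show "\<bar>f ((x(j := y))(i := y0)) - f (x(i := y0))\<bar> \<le> c j"
      using insert.prems(2)[OF upd[OF *(1) y0], of j y] * by (simp del: fun_upd_apply)
  qed
  then obtain B where B: "\<And>x. x \<in> space (PiM I M) \<Longrightarrow> \<bar>f (x(i := y0))\<bar> \<le> B"
    by blast
  have "\<bar>f x\<bar> \<le> B + c i" if x: "x \<in> space (PiM (insert i I) M)" for x
  proof -
    \<comment> \<open>The restriction of \<open>x\<close> to \<open>I\<close> differs from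
      \<open>x\<close> only at \<open>i\<close>, and overwriting \<open>i\<close> hides this, so the
      induction hypothesis applies.\<close>
    have "(restrict x I)(i := y0) = x(i := y0)"
      using x insert.hyps by (auto simp: space_PiM fun_eq_iff PiE_def extensional_def)
    moreover have "restrict x I \<in> space (PiM I M)"
      using x by (auto simp: space_PiM)
    ultimately have "\<bar>f (x(i := y0))\<bar> \<le> B"
      using B[of "restrict x I"] by simp
    with insert.prems(2)[OF x, of i y0] y0 show ?thesis by (simp del: fun_upd_apply)
  qed
  then show ?case by blast
qed

lemma integrable_of_bounded_differences:
  fixes f :: "('i \<Rightarrow> 'a) \<Rightarrow> real"
  assumes M: "\<And>i. prob_space (M i)" and "finite I" and f: "f \<in> borel_measurable (PiM I M)"
    and diff: "\<And>x i y. x \<in> space (PiM I M) \<Longrightarrow> i \<in> I \<Longrightarrow> y \<in> space (M i) \<Longrightarrow>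
      \<bar>f (x(i := y)) - f x\<bar> \<le> c i"
  shows "integrable (PiM I M) f"
proof -
  interpret PiM: prob_space "PiM I M"
    by (rule prob_space_PiM[OF M])
  have "\<exists>B. \<forall>x\<in>space (PiM I M). \<bar>f x\<bar> \<le> B"
    by (rule bounded_of_bounded_differences[where f = f and c = c, OF \<open>finite I\<close> prob_space.not_empty[OF M] diff])
  then obtain B where "\<And>x. x \<in> space (PiM I M) \<Longrightarrow> \<bar>f x\<bar> \<le> B"
    by blast
  then show ?thesis
    by (intro PiM.integrable_const_bound[where B = B] f) (auto intro: AE_I2)
qed

text \<open>One coordinate is integrated out at a time. The average over coordinate \<open>i\<close>
  keeps the differences in the other coordinates, and around that average \<open>f\<close> has a
  range of width \<open>c i\<close>, so Hoeffding's lemma contributes one factor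
  \<open>exp (l\<^sup>2 * (c i)\<^sup>2 / 8)\<close>.\<close>

lemma mgf_of_bounded_differences:
  fixes f :: "('i \<Rightarrow> 'a) \<Rightarrow> real" and l :: real
  assumes M: "\<And>i. prob_space (M i)" and "finite I" and l: "l > 0" and f: "f \<in> borel_measurable (PiM I M)"
    and diff: "\<And>x i y. x \<in> space (PiM I M) \<Longrightarrow> i \<in> I \<Longrightarrow> y \<in> space (M i) \<Longrightarrow>
      \<bar>f (x(i := y)) - f x\<bar> \<le> c i"
  shows "(\<integral>\<^sup>+x. ennreal (exp (l * (f x - integral\<^sup>L (PiM I M) f))) \<partial>PiM I M)
    \<le> ennreal (exp (l\<^sup>2 * (\<Sum>i\<in>I. (c i)\<^sup>2) / 8))"
  using assms(2) f diff
proof (induction I arbitrary: f rule: finite_induct)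
  case empty
  have "integral\<^sup>L (PiM {} M) f = f (\<lambda>_. undefined)"
    by (simp add: PiM_empty lebesgue_integral_count_space_finite)
  then show ?case
    by (simp add: PiM_empty nn_integral_count_space_finite)
next
  case (insert i I)
  interpret product_prob_space M "insert i I"
    by (intro product_prob_spaceI M)
  note [measurable] = insert.prems(1)
  note diff = insert.prems(2)
  define g where "g x = (\<integral>y. f (x(i := y)) \<partial>M i)" for x
  have int_f: "integrable (PiM (insert i I) M) f"
    by (rule integrable_of_bounded_differences[where f = f and c = c, OF M _ _ diff]) (use insert.hyps in auto)
  have "\<exists>B. \<forall>x\<in>space (PiM (insert i I) M). \<bar>f x\<bar> \<le> B"
    by (rule bounded_of_bounded_differences[where f = f and c = c, OF _ prob_space.not_empty[OF M] diff]) (use insert.hyps in auto)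
  then obtain B where B: "\<And>x. x \<in> space (PiM (insert i I) M) \<Longrightarrow> \<bar>f x\<bar> \<le> B"
    by blast
  have upd: "x(i := y) \<in> space (PiM (insert i I) M)"
    if "x \<in> space (PiM I M)" "y \<in> space (M i)" for x y
    using that by (auto simp: space_PiM PiE_def extensional_def)
  have slice_meas[measurable]: "(\<lambda>y. f (x(i := y))) \<in> borel_measurable (M i)"
    if "x \<in> space (PiM I M)" for x
    using that by measurable
  have slice_int: "integrable (M i) (\<lambda>y. f (x(i := y)))" if "x \<in> space (PiM I M)" for x
    by (rule M.integrable_const_bound[where B = B]) (use that B upd in \<open>auto intro!: AE_I2\<close>)
  have g_meas[measurable]: "g \<in> borel_measurable (PiM I M)"
    unfolding g_def by measurable
  have g_diff: "\<bar>g (x(j := z)) - g x\<bar> \<le> c j"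
    if x: "x \<in> space (PiM I M)" and j: "j \<in> I" and z: "z \<in> space (M j)" for x j z
  proof -
    have xz: "x(j := z) \<in> space (PiM I M)"
      using x j z by (auto simp: space_PiM PiE_def extensional_def)
    have "\<bar>g (x(j := z)) - g x\<bar> = \<bar>\<integral>y. f ((x(j := z))(i := y)) - f (x(i := y)) \<partial>M i\<bar>"
      unfolding g_def using slice_int[OF x] slice_int[OF xz] by simp
    also have "\<dots> \<le> (\<integral>y. \<bar>f ((x(j := z))(i := y)) - f (x(i := y))\<bar> \<partial>M i)"
      by (rule integral_abs_bound)
    also have "\<dots> \<le> (\<integral>y. c j \<partial>M i)"
    proof (rule integral_mono)
      fix y assume y: "y \<in> space (M i)"
      have "(x(j := z))(i := y) = (x(i := y))(j := z)"
        using j insert.hyps by (auto simp: fun_upd_twist)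
      then show "\<bar>f ((x(j := z))(i := y)) - f (x(i := y))\<bar> \<le> c j"
        using diff[OF upd[OF x y], of j z] j z by (simp del: fun_upd_apply)
    qed (use slice_int[OF x] slice_int[OF xz] in auto)
    also have "\<dots> = c j" by (simp add: M.prob_space)
    finally show ?thesis .
  qed
  have E: "integral\<^sup>L (PiM (insert i I) M) f = integral\<^sup>L (PiM I M) g"
    unfolding g_def by (rule product_integral_insert[OF insert.hyps int_f])
  have inner: "(\<integral>\<^sup>+y. ennreal (exp (l * (f (x(i := y)) - g x))) \<partial>M i)
    \<le> ennreal (exp (l\<^sup>2 * (c i)\<^sup>2 / 8))" if x: "x \<in> space (PiM I M)" for x
  proof -
    \<comment> \<open>Any two values of the section differ by at most \<open>c i\<close>, so an
      interval of width \<open>c i\<close>, not \<open>2 * c i\<close>, starting at the infimum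
      contains them all. The constant 8 depends on this.\<close>
    define a where "a = (INF y\<in>space (M i). f (x(i := y)))"
    have bdd: "bdd_below ((\<lambda>y. f (x(i := y))) ` space (M i))"
      by (rule bdd_belowI[where m = "- B"]) (use B[OF upd[OF x]] in \<open>auto simp: abs_le_iff\<close>, smt (verit))
    have "f (x(i := y)) \<in> {a..a + c i}" if y: "y \<in> space (M i)" for y
    proof -
      have "a \<le> f (x(i := y))"
        unfolding a_def by (rule cINF_lower[OF bdd y])
      moreover have "f (x(i := y)) - c i \<le> a"
        unfolding a_def
      proof (rule cINF_greatest[OF prob_space.not_empty[OF M]])
        fix z assume "z \<in> space (M i)"
        then show "f (x(i := y)) - c i \<le> f (x(i := z))"
          using diff[OF upd[OF x y], of i z] by (simp del: fun_upd_apply)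
      qed
      ultimately show ?thesis by simp
    qed
    then interpret interval_bounded_random_variable "M i" "\<lambda>y. f (x(i := y))" a "a + c i"
      using x by unfold_locales (auto intro!: AE_I2)
    show ?thesis
      using Hoeffdings_lemma_nn_integral[OF l] by (simp add: g_def)
  qed
  define m where "m = integral\<^sup>L (PiM I M) g"
  have split: "exp (l * (f (x(i := y)) - m)) = exp (l * (g x - m)) * exp (l * (f (x(i := y)) - g x))"
    for x y
    by (simp add: exp_add[symmetric] algebra_simps)
  \<comment> \<open>By Fubini the factor in \<open>g x\<close> leaves the inner integral, which
    \<open>inner\<close> bounds; the rest is the induction hypothesis for \<open>g\<close>.\<close>
  have "(\<integral>\<^sup>+x. ennreal (exp (l * (f x - m))) \<partial>PiM (insert i I) M)
      = (\<integral>\<^sup>+x. \<integral>\<^sup>+y. ennreal (exp (l * (f (x(i := y)) - m))) \<partial>M i \<partial>PiM I M)"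
    by (rule product_nn_integral_insert[OF insert.hyps]) measurable
  also have "\<dots> = (\<integral>\<^sup>+x. ennreal (exp (l * (g x - m))) *
      (\<integral>\<^sup>+y. ennreal (exp (l * (f (x(i := y)) - g x))) \<partial>M i) \<partial>PiM I M)"
    by (intro nn_integral_cong) (simp add: split ennreal_mult nn_integral_cmult)
  also have "\<dots> \<le> (\<integral>\<^sup>+x. ennreal (exp (l * (g x - m))) * ennreal (exp (l\<^sup>2 * (c i)\<^sup>2 / 8)) \<partial>PiM I M)"
    by (intro nn_integral_mono mult_left_mono inner) auto
  also have "\<dots> = (\<integral>\<^sup>+x. ennreal (exp (l * (g x - m))) \<partial>PiM I M) * ennreal (exp (l\<^sup>2 * (c i)\<^sup>2 / 8))"
    by (rule nn_integral_multc) measurable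
  also have "\<dots> \<le> ennreal (exp (l\<^sup>2 * (\<Sum>i\<in>I. (c i)\<^sup>2) / 8)) * ennreal (exp (l\<^sup>2 * (c i)\<^sup>2 / 8))"
    unfolding m_def by (intro mult_right_mono insert.IH g_meas g_diff) auto
  also have "\<dots> = ennreal (exp (l\<^sup>2 * (\<Sum>i\<in>insert i I. (c i)\<^sup>2) / 8))"
    using insert.hyps
    by (simp add: ennreal_mult[symmetric] exp_add[symmetric] algebra_simps add_divide_distrib)
  finally show ?case
    by (simp add: E m_def)
qed

text \<open>The exponential Markov inequality applied to the moment bound above.\<close>

lemma McDiarmid:
  fixes f :: "('i \<Rightarrow> 'a) \<Rightarrow> real" and t :: real
  assumes M: "\<And>i. prob_space (M i)" and "finite I" and t: "t > 0" and f[measurable]: "f \<in> borel_measurable (PiM I M)"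
    and diff: "\<And>x i y. x \<in> space (PiM I M) \<Longrightarrow> i \<in> I \<Longrightarrow> y \<in> space (M i) \<Longrightarrow>
      \<bar>f (x(i := y)) - f x\<bar> \<le> c i"
    and c: "(\<Sum>i\<in>I. (c i)\<^sup>2) > 0"
  shows "measure (PiM I M) {x \<in> space (PiM I M). f x - integral\<^sup>L (PiM I M) f \<ge> t}
    \<le> exp (- 2 * t\<^sup>2 / (\<Sum>i\<in>I. (c i)\<^sup>2))"
proof -
  interpret PiM: prob_space "PiM I M"
    by (rule prob_space_PiM[OF M])
  define C where "C = (\<Sum>i\<in>I. (c i)\<^sup>2)"
  define m where "m = integral\<^sup>L (PiM I M) f"
  \<comment> \<open>The minimizer of \<open>- l * t + l\<^sup>2 * C / 8\<close>.\<close>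
  define l where "l = 4 * t / C"
  have C: "C > 0" and l: "l > 0"
    using c t by (simp_all add: C_def l_def)
  have exponent: "- l * t + l\<^sup>2 * C / 8 = - 2 * t\<^sup>2 / C"
    using C by (simp add: l_def power2_eq_square field_simps)
  have "emeasure (PiM I M) {x \<in> space (PiM I M). f x - m \<ge> t}
      = (\<integral>\<^sup>+x. indicator {x \<in> space (PiM I M). f x - m \<ge> t} x \<partial>PiM I M)"
    by simp
  also have "\<dots> \<le> (\<integral>\<^sup>+x. ennreal (exp (- l * t)) * ennreal (exp (l * (f x - m))) \<partial>PiM I M)"
  proof (intro nn_integral_mono)
    fix x
    show "indicator {x \<in> space (PiM I M). f x - m \<ge> t} x
        \<le> ennreal (exp (- l * t)) * ennreal (exp (l * (f x - m)))"
    proof (cases "f x - m \<ge> t")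
      case True
      then have "0 \<le> l * (f x - m - t)" using l by simp
      then have "1 \<le> exp (- l * t) * exp (l * (f x - m))"
        by (simp add: algebra_simps flip: exp_add)
      then have "1 \<le> ennreal (exp (- l * t) * exp (l * (f x - m)))"
        by simp
      then show ?thesis
        by (simp add: ennreal_mult indicator_def)
    qed (simp add: indicator_def)
  qed
  also have "\<dots> = ennreal (exp (- l * t)) * (\<integral>\<^sup>+x. ennreal (exp (l * (f x - m))) \<partial>PiM I M)"
    by (rule nn_integral_cmult) measurable
  also have "\<dots> \<le> ennreal (exp (- l * t)) * ennreal (exp (l\<^sup>2 * C / 8))"
    unfolding m_def C_def
    by (intro mult_left_mono mgf_of_bounded_differences[OF M \<open>finite I\<close> l f diff]) auto
  also have "\<dots> = ennreal (exp (- 2 * t\<^sup>2 / C))"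
    using exponent by (simp add: ennreal_mult[symmetric] exp_add[symmetric])
  finally show ?thesis
    by (simp add: PiM.emeasure_eq_measure m_def C_def)
qed

section \<open>Order statistics and prediction sets\<close>

text \<open>In a sorted list the entries below \<open>y\<close> form an initial segment; position
  \<open>k\<close>, counted from 0, lies in it when the segment has more than \<open>k\<close>
  entries.\<close>

lemma nth_sorted_less_iff:
  fixes xs :: "'a :: linorder list"
  assumes "sorted xs" "k < length xs"
  shows "xs ! k < y \<longleftrightarrow> k < length (filter (\<lambda>x. x < y) xs)"
proof -
  have *: "length (filter (\<lambda>x. x < y) xs) = card {i. i < length xs \<and> xs ! i < y}"
    by (rule length_filter_conv_card)
  show ?thesis
  proof
    assume "xs ! k < y"
    then have "{..k} \<subseteq> {i. i < length xs \<and> xs ! i < y}"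
      using assms by (auto dest: sorted_nth_mono le_less_trans)
    then have "card {..k} \<le> card {i. i < length xs \<and> xs ! i < y}"
      by (intro card_mono) auto
    with * show "k < length (filter (\<lambda>x. x < y) xs)" by simp
  next
    assume less: "k < length (filter (\<lambda>x. x < y) xs)"
    show "xs ! k < y"
    proof (rule ccontr)
      assume "\<not> xs ! k < y"
      then have "i < k" if "i < length xs" "xs ! i < y" for i
        using assms that sorted_nth_mono[of xs k i] by (meson le_less_trans not_le)
      then have "card {i. i < length xs \<and> xs ! i < y} \<le> card {..<k}"
        by (intro card_mono) auto
      with less * show False by simp
    qed
  qed
qed

lemma nth_sorted_le_iff:
  fixes xs :: "'a :: linorder list"
  assumes "sorted xs" "k < length xs"
  shows "xs ! k \<le> y \<longleftrightarrow> k < length (filter (\<lambda>x. x \<le> y) xs)"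
proof -
  have *: "length (filter (\<lambda>x. x \<le> y) xs) = card {i. i < length xs \<and> xs ! i \<le> y}"
    by (rule length_filter_conv_card)
  show ?thesis
  proof
    assume "xs ! k \<le> y"
    then have "{..k} \<subseteq> {i. i < length xs \<and> xs ! i \<le> y}"
      using assms by (auto dest: sorted_nth_mono order_trans)
    then have "card {..k} \<le> card {i. i < length xs \<and> xs ! i \<le> y}"
      by (intro card_mono) auto
    with * show "k < length (filter (\<lambda>x. x \<le> y) xs)" by simp
  next
    assume less: "k < length (filter (\<lambda>x. x \<le> y) xs)"
    show "xs ! k \<le> y"
    proof (rule ccontr)
      assume "\<not> xs ! k \<le> y"
      then have "i < k" if "i < length xs" "xs ! i \<le> y" for i
        using assms that sorted_nth_mono[of xs k i] by (meson order_trans not_le)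
      then have "card {i. i < length xs \<and> xs ! i \<le> y} \<le> card {..<k}"
        by (intro card_mono) auto
      with less * show False by simp
    qed
  qed
qed

lemma length_sorted_list_of_multiset: "length (sorted_list_of_multiset A) = size A"
  by (metis mset_sorted_list_of_multiset size_mset)

lemma length_filter_sorted_image_mset:
  "length (filter Q (sorted_list_of_multiset {# a i. i \<in># mset [0..<n] #})) = card {i. i < n \<and> Q (a i)}"
proof -
  have "length (filter Q (sorted_list_of_multiset {# a i. i \<in># mset [0..<n] #}))
      = size (filter_mset Q (mset (map a [0..<n])))"
    by (metis mset_filter mset_map mset_sorted_list_of_multiset size_mset)
  also have "\<dots> = length (filter Q (map a [0..<n]))"
    by (metis mset_filter size_mset)
  also have "\<dots> = card {i. i < n \<and> Q (a i)}"
    unfolding length_filter_conv_card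
    by (intro arg_cong[where f = card]) auto
  finally show ?thesis .
qed

text \<open>Order statistics are traded for counts of indices, which are easily seen to be
  measurable and are easy to compare when the predictors are perturbed.\<close>

lemma kth_smallest_less_iff:
  assumes "1 \<le> k" "k \<le> n"
  shows "kth_smallest k {# a i. i \<in># mset [0..<n] #} < y \<longleftrightarrow> k \<le> card {i. i < n \<and> a i < y}"
  unfolding kth_smallest_def using assms
  by (subst nth_sorted_less_iff)
    (auto simp: length_filter_sorted_image_mset length_sorted_list_of_multiset simp del: mset_upt)

lemma less_kth_smallest_iff:
  assumes "1 \<le> k" "k \<le> n"
  shows "y < kth_smallest k {# a i. i \<in># mset [0..<n] #} \<longleftrightarrow> n - k < card {i. i < n \<and> y < a i}"
proof -
  have "card {i. i < n \<and> a i \<le> y} + card {i. i < n \<and> y < a i}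
      = card ({i. i < n \<and> a i \<le> y} \<union> {i. i < n \<and> y < a i})"
    by (intro card_Un_disjoint[symmetric]) auto
  also have "{i. i < n \<and> a i \<le> y} \<union> {i. i < n \<and> y < a i} = {..<n}"
    by auto
  finally have sum: "card {i. i < n \<and> a i \<le> y} + card {i. i < n \<and> y < a i} = n"
    by simp
  have "kth_smallest k {# a i. i \<in># mset [0..<n] #} \<le> y \<longleftrightarrow> k - 1 < card {i. i < n \<and> a i \<le> y}"
    unfolding kth_smallest_def using assms
    by (subst nth_sorted_le_iff)
      (auto simp: length_filter_sorted_image_mset length_sorted_list_of_multiset simp del: mset_upt)
  then show ?thesis
    using sum assms by linarith
qed

text \<open>A natural number reaches the ceiling of a real as soon as it reaches the real itself.
  The infinite endpoint becomes the condition on \<open>\<alpha>\<close>, which also keeps the rank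
  at most \<open>n\<close>.\<close>

lemma q_plus_less_iff:
  assumes "\<alpha> < 1"
  shows "q_plus \<alpha> {# a i. i \<in># mset [0..<n] #} < ereal y \<longleftrightarrow>
    \<alpha> \<ge> 1 / (real n + 1) \<and> (1 - \<alpha>) * (real n + 1) \<le> real (card {i. i < n \<and> a i < y})"
proof (cases "\<alpha> < 1 / (real n + 1)")
  case True
  then show ?thesis by (simp add: q_plus_def)
next
  case False
  define k where "k = nat \<lceil>(1 - \<alpha>) * (real n + 1)\<rceil>"
  have pos: "(1 - \<alpha>) * (real n + 1) > 0" using assms by simp
  have "1 \<le> k" using pos by (simp add: k_def) linarith
  moreover have "(1 - \<alpha>) * (real n + 1) \<le> real n"
    using False by (simp add: field_simps)
  then have "k \<le> n" by (simp add: k_def ceiling_le_iff)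
  moreover have "k \<le> j \<longleftrightarrow> (1 - \<alpha>) * (real n + 1) \<le> real j" for j
    by (simp add: k_def ceiling_le_iff nat_le_iff)
  ultimately show ?thesis
    using False kth_smallest_less_iff[of k n a y] by (simp add: q_plus_def k_def)
qed

text \<open>The floor of \<open>\<alpha> * (n + 1)\<close> and the ceiling of
  \<open>(1 - \<alpha>) * (n + 1)\<close> add up to \<open>n + 1\<close>, so the lower endpoint
  leads to the same threshold as the upper one.\<close>

lemma less_q_minus_iff:
  assumes "\<alpha> < 1"
  shows "ereal y < q_minus \<alpha> {# a i. i \<in># mset [0..<n] #} \<longleftrightarrow>
    \<alpha> \<ge> 1 / (real n + 1) \<and> (1 - \<alpha>) * (real n + 1) \<le> real (card {i. i < n \<and> y < a i})"
proof (cases "\<alpha> < 1 / (real n + 1)")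
  case True
  then show ?thesis by (simp add: q_minus_def)
next
  case False
  define k where "k = nat \<lfloor>\<alpha> * (real n + 1)\<rfloor>"
  have ge: "\<alpha> * (real n + 1) \<ge> 1" using False by (simp add: field_simps)
  have "1 \<le> k" using ge by (simp add: k_def le_nat_iff le_floor_iff)
  moreover have "\<alpha> * (real n + 1) < real n + 1"
    using assms by (simp add: mult_less_cancel_right)
  then have "k \<le> n" using ge by (simp add: k_def nat_le_iff floor_le_iff)
  moreover have "n - k < j \<longleftrightarrow> (1 - \<alpha>) * (real n + 1) \<le> real j" for j
  proof -
    \<comment> \<open>Truncated subtraction does no harm: for \<open>j > n\<close> both sides
      hold.\<close>
    have "n - k < j \<longleftrightarrow> n + 1 - j \<le> k" using \<open>k \<le> n\<close> by linarith
    also have "\<dots> \<longleftrightarrow> int n + 1 - int j \<le> \<lfloor>\<alpha> * (real n + 1)\<rfloor>"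
      using ge by (simp add: k_def) linarith
    also have "\<dots> \<longleftrightarrow> real n + 1 - real j \<le> \<alpha> * (real n + 1)"
      by (simp add: le_floor_iff)
    finally show ?thesis by (simp add: algebra_simps)
  qed
  ultimately show ?thesis
    using False less_kth_smallest_iff[of k n y a] by (simp add: q_minus_def k_def)
qed

lemma notin_jackknife_plus_iff:
  assumes "\<alpha> < 1"
  shows "y \<notin> jackknife_plus \<mu> T \<alpha> zs x \<longleftrightarrow> \<alpha> \<ge> 1 / (real (length zs) + 1) \<and>
    ((1 - \<alpha>) * (real (length zs) + 1) \<le>
       real (card {i. i < length zs \<and> y < \<mu> (T (delete_nth i zs)) x - loo_resid \<mu> T zs i}) \<or>
     (1 - \<alpha>) * (real (length zs) + 1) \<le>
       real (card {i. i < length zs \<and> \<mu> (T (delete_nth i zs)) x + loo_resid \<mu> T zs i < y}))"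
  unfolding jackknife_plus_def mem_Collect_eq de_Morgan_conj not_le
    q_plus_less_iff[OF assms] less_q_minus_iff[OF assms]
  by blast

text \<open>If \<open>y\<close> lies beyond either end of the \<open>i\<close>-th interval, its
  distance to the \<open>i\<close>-th prediction exceeds the \<open>i\<close>-th leave-one-out
  residual. Passing to \<open>g\<close> costs \<open>\<Delta>\<close> at the training point and
  \<open>\<Delta>\<close> at \<open>x\<close>, hence \<open>2 * \<Delta>\<close>.\<close>

lemma jackknife_plus_miss_count:
  assumes "\<alpha> < 1" and x: "x \<in> X" and zs: "\<And>i. i < length zs \<Longrightarrow> fst (zs ! i) \<in> X"
    and close: "\<And>i x. i < length zs \<Longrightarrow> x \<in> X \<Longrightarrow> \<bar>\<mu> (T (delete_nth i zs)) x - g x\<bar> \<le> \<Delta>"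
    and miss: "y \<notin> jackknife_plus \<mu> T \<alpha> zs x"
  shows "(1 - \<alpha>) * real (length zs) \<le> real (card {i. i < length zs \<and>
    \<bar>snd (zs ! i) - g (fst (zs ! i))\<bar> < \<bar>y - g x\<bar> + 2 * \<Delta>})"
    (is "_ \<le> real (card ?C)")
proof -
  let ?b = "\<lambda>i. \<mu> (T (delete_nth i zs))"
  have bound: "i \<in> ?C" if i: "i < length zs"
    and "y < ?b i x - loo_resid \<mu> T zs i \<or> ?b i x + loo_resid \<mu> T zs i < y" for i
    using that(2) close[OF i x] close[OF i zs[OF i]] i unfolding loo_resid_def abs_le_iff
    by (auto simp: abs_if split: if_splits)
  have "card {i. i < length zs \<and> y < ?b i x - loo_resid \<mu> T zs i} \<le> card ?C"
    "card {i. i < length zs \<and> ?b i x + loo_resid \<mu> T zs i < y} \<le> card ?C"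
    using bound by (auto intro!: card_mono simp del: mem_Collect_eq)
  moreover have "(1 - \<alpha>) * real (length zs) \<le> (1 - \<alpha>) * (real (length zs) + 1)"
    using \<open>\<alpha> < 1\<close> by simp
  ultimately show ?thesis
    using miss unfolding notin_jackknife_plus_iff[OF \<open>\<alpha> < 1\<close>] by linarith
qed

section \<open>Distribution functions and conditional probabilities\<close>

lemma infnorm_le_iff: "infnorm (v :: real ^ 'p) \<le> t \<longleftrightarrow> (\<forall>j. \<bar>v $ j\<bar> \<le> t)"
proof
  assume "\<forall>j. \<bar>v $ j\<bar> \<le> t"
  then show "infnorm v \<le> t"
    unfolding infnorm_cart by (intro cSup_least) auto
qed (meson component_le_infnorm_cart order_trans)

text \<open>
  The infimum of the McShane envelopes over a countable dense set of parameters recovers the family.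
\<close>

lemma borel_measurable_lipschitz_family:
  fixes \<mu> :: "'b :: euclidean_space \<Rightarrow> 'a \<Rightarrow> real"
  assumes meas: "\<And>\<beta>. \<mu> \<beta> \<in> borel_measurable N"
    and lip: "\<And>\<beta> \<beta>' x. x \<in> space N \<Longrightarrow> \<bar>\<mu> \<beta> x - \<mu> \<beta>' x\<bar> \<le> K * norm (\<beta> - \<beta>')"
  shows "(\<lambda>(\<beta>, x). \<mu> \<beta> x) \<in> borel_measurable ((borel :: 'b measure) \<Otimes>\<^sub>M N)"
proof -
  obtain D :: "'b set" where D: "countable D" "\<And>X. open X \<Longrightarrow> X \<noteq> {} \<Longrightarrow> \<exists>d\<in>D. d \<in> X"
    using countable_dense_setE by blast
  have "D \<noteq> {}" using D(2)[of UNIV] by auto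
  note [measurable] = meas
  have lower: "\<mu> \<beta> x \<le> \<mu> d x + K * norm (\<beta> - d)" if "x \<in> space N" for d \<beta> x
    using lip[OF that, of \<beta> d] by (simp add: abs_le_iff)
  have "(\<lambda>z. INF d\<in>D. \<mu> d (snd z) + K * norm (fst z - d)) \<in> borel_measurable ((borel :: 'b measure) \<Otimes>\<^sub>M N)"
  proof (rule borel_measurable_cINF[OF D(1)])
    fix z assume "z \<in> space ((borel :: 'b measure) \<Otimes>\<^sub>M N)"
    then show "bdd_below ((\<lambda>d. \<mu> d (snd z) + K * norm (fst z - d)) ` D)"
      by (intro bdd_belowI2[where m = "\<mu> (fst z) (snd z)"] lower) (auto simp: space_pair_measure)
  qed measurable
  moreover have "(INF d\<in>D. \<mu> d x + K * norm (\<beta> - d)) = \<mu> \<beta> x" if x: "x \<in> space N" for \<beta> x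
  proof (rule cInf_eq_non_empty)
    show "(\<lambda>d. \<mu> d x + K * norm (\<beta> - d)) ` D \<noteq> {}" using \<open>D \<noteq> {}\<close> by simp
    show "\<mu> \<beta> x \<le> v" if "v \<in> (\<lambda>d. \<mu> d x + K * norm (\<beta> - d)) ` D" for v
      using that lower[OF x] by auto
    fix v assume v: "\<And>w. w \<in> (\<lambda>d. \<mu> d x + K * norm (\<beta> - d)) ` D \<Longrightarrow> v \<le> w"
    show "v \<le> \<mu> \<beta> x"
    proof (rule field_le_epsilon)
      fix e :: real assume e: "e > 0"
      \<comment> \<open>The factor \<open>\<bar>K\<bar> + 1\<close> is positive whatever
        \<open>K\<close> is; at distance below \<open>r\<close> the two Lipschitz errors add up to
        at most \<open>e\<close>.\<close>
      define r where "r = e / (2 * (\<bar>K\<bar> + 1))"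
      have "r > 0" using e by (simp add: r_def)
      then obtain d where d: "d \<in> D" "dist \<beta> d < r"
        using D(2)[of "ball \<beta> r"] by auto
      have "v \<le> \<mu> d x + K * norm (\<beta> - d)" using v d by auto
      moreover have "\<mu> d x \<le> \<mu> \<beta> x + K * norm (\<beta> - d)"
        using lip[OF x, of \<beta> d] by (simp add: abs_le_iff)
      moreover have "K * norm (\<beta> - d) \<le> (\<bar>K\<bar> + 1) * r"
        using d by (intro mult_mono) (auto simp: dist_norm)
      moreover have "2 * ((\<bar>K\<bar> + 1) * r) = e" by (simp add: r_def field_simps)
      ultimately show "v \<le> \<mu> \<beta> x + e" by linarith
    qed
  qed
  ultimately show ?thesis
    by (subst measurable_cong[where g = "\<lambda>z. INF d\<in>D. \<mu> d (snd z) + K * norm (fst z - d)"])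
      (auto simp: space_pair_measure)
qed

text \<open>A density bounded by \<open>L\<close> puts mass at most \<open>L * r\<close> on an
  interval of length \<open>r\<close>.\<close>

lemma has_density_increment_le:
  assumes F: "has_density F f" and f: "\<And>t. f t \<le> L" and F_nonneg: "\<And>t. 0 \<le> F t" and "r \<ge> 0"
  shows "F v \<le> F (v - r) + L * r"
proof -
  have [measurable]: "f \<in> borel_measurable borel" and "\<And>s. 0 \<le> f s"
    using F by (auto simp: has_density_def)
  with f have "0 \<le> L" by (meson order_trans)
  have "ennreal (F v) = (\<integral>\<^sup>+s. ennreal (f s) * indicator {..v} s \<partial>lborel)"
    using F by (auto simp: has_density_def)
  also have "\<dots> \<le> (\<integral>\<^sup>+s. ennreal (f s) * indicator {..v - r} s + ennreal L * indicator {v - r..v} s \<partial>lborel)"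
    by (intro nn_integral_mono) (auto simp: indicator_def f ennreal_leI)
  also have "\<dots> = (\<integral>\<^sup>+s. ennreal (f s) * indicator {..v - r} s \<partial>lborel)
      + (\<integral>\<^sup>+s. ennreal L * indicator {v - r..v} s \<partial>lborel)"
    by (rule nn_integral_add) auto
  also have "(\<integral>\<^sup>+s. ennreal (f s) * indicator {..v - r} s \<partial>lborel) = ennreal (F (v - r))"
    using F by (auto simp: has_density_def)
  also have "(\<integral>\<^sup>+s. ennreal L * indicator {v - r..v} s \<partial>lborel) = ennreal (L * r)"
    using \<open>r \<ge> 0\<close> \<open>0 \<le> L\<close> by (simp add: nn_integral_cmult_indicator ennreal_mult)
  finally show ?thesis
    using F_nonneg \<open>r \<ge> 0\<close> \<open>0 \<le> L\<close> by (simp flip: ennreal_plus)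
qed

text \<open>One half of the probability integral transform: \<open>F\<close> applied to
  \<open>S\<close> is stochastically no smaller than a uniform variable. The set where
  \<open>F\<close> is below \<open>u\<close> is a down-set of the line, so its mass is controlled by
  \<open>F\<close> at, or just left of, its supremum.\<close>

lemma (in prob_space) prob_cdf_less_le:
  fixes S :: "'a \<Rightarrow> real"
  assumes [measurable]: "S \<in> borel_measurable M" and "0 \<le> u"
  shows "prob {x \<in> space M. prob {y \<in> space M. S y \<le> S x} < u} \<le> u"
proof -
  define F where "F t = prob {y \<in> space M. S y \<le> t}" for t
  define A where "A = {t. F t < u}"
  have F_mono: "F s \<le> F t" if "s \<le> t" for s t
    unfolding F_def using that by (intro finite_measure_mono) auto
  have [measurable]: "F \<in> borel_measurable borel"
    by (rule borel_measurable_mono) (auto simp: mono_def F_mono)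
  \<comment> \<open>For \<open>u < 1\<close> the limit 1 of \<open>F\<close> at infinity bounds
    \<open>A\<close> above, so its supremum is meaningful.\<close>
  have tail: "\<exists>t. s < F t" if "s < 1" for s
  proof -
    interpret D: real_distribution "distr M borel S"
      by (rule real_distribution_distr) simp
    have "cdf (distr M borel S) = F"
      by (auto simp: fun_eq_iff cdf_def F_def measure_distr intro!: arg_cong[where f = prob])
    then have "(F \<longlongrightarrow> 1) at_top" using D.cdf_lim_at_top_prob by simp
    then have "eventually (\<lambda>t. s < F t) at_top" using that by (rule order_tendstoD)
    then show ?thesis by (auto dest: eventually_happens)
  qed
  have prob_A: "prob {x \<in> space M. S x \<in> A} \<le> u"
  proof (cases "A = {} \<or> 1 \<le> u")
    case True
    then show ?thesis using \<open>0 \<le> u\<close> by (auto intro: order_trans[OF prob_le_1])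
  next
    case False
    then obtain t0 where "u \<le> F t0" using tail[of u] by (meson less_imp_le not_le)
    then have "t \<le> t0" if "t \<in> A" for t
      using that F_mono[of t0 t] by (cases "t \<le> t0") (auto simp: A_def)
    then have bdd: "bdd_above A" by (rule bdd_aboveI)
    define a where "a = Sup A"
    have le_a: "t \<le> a" if "t \<in> A" for t
      using that bdd by (simp add: a_def cSup_upper)
    show ?thesis
    proof (cases "a \<in> A")
      case True
      have "prob {x \<in> space M. S x \<in> A} \<le> F a"
        unfolding F_def by (intro finite_measure_mono) (auto intro: le_a)
      also have "\<dots> \<le> u" using True by (simp add: A_def)
      finally show ?thesis .
    next
      case a: False
      have below: "F t \<le> u" if "t < a" for t
      proof -
        obtain s where "s \<in> A" "t < s"
          using \<open>t < a\<close> False by (auto simp: a_def less_cSup_iff[OF _ bdd])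
        then show ?thesis using F_mono[of t s] by (simp add: A_def)
      qed
      \<comment> \<open>The supremum is not attained here, so \<open>A\<close> is covered by the
        increasing half-lines ending at \<open>a - 1 / Suc i\<close>, and continuity from below
        passes the bound to their union.\<close>
      have "(\<lambda>i. F (a - 1 / Suc i)) \<longlonglongrightarrow> prob (\<Union>i. {y \<in> space M. S y \<le> a - 1 / Suc i})"
        unfolding F_def
      proof (rule finite_Lim_measure_incseq)
        show "incseq (\<lambda>i. {y \<in> space M. S y \<le> a - 1 / real (Suc i)})"
          by (rule incseq_SucI) (auto elim!: order_trans intro!: divide_left_mono)
      qed auto
      then have "prob (\<Union>i. {y \<in> space M. S y \<le> a - 1 / Suc i}) \<le> u"
        by (rule LIMSEQ_le_const2) (auto intro!: below)
      moreover have "{x \<in> space M. S x \<in> A} \<subseteq> (\<Union>i. {y \<in> space M. S y \<le> a - 1 / Suc i})"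
      proof
        fix x assume x: "x \<in> {x \<in> space M. S x \<in> A}"
        then have "S x < a" using le_a[of "S x"] a by (cases "S x = a") auto
        then obtain i where "inverse (real (Suc i)) < a - S x"
          using reals_Archimedean[of "a - S x"] by auto
        then show "x \<in> (\<Union>i. {y \<in> space M. S y \<le> a - 1 / Suc i})"
          using x by (auto simp: inverse_eq_divide intro!: exI[of _ i])
      qed
      then have "prob {x \<in> space M. S x \<in> A} \<le> prob (\<Union>i. {y \<in> space M. S y \<le> a - 1 / Suc i})"
        by (intro finite_measure_mono) auto
      ultimately show ?thesis by linarith
    qed
  qed
  then show ?thesis by (simp add: A_def F_def)
qed

text \<open>The hypothesis on the joint law is the independence of \<open>D\<close> and
  \<open>W\<close>: conditioning on \<open>D\<close> freezes its value and only \<open>W\<close> is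
  averaged. This turns the abstract conditional expectation into a concrete section measure.\<close>

lemma (in prob_space) cond_prob_given_indep:
  fixes D :: "'a \<Rightarrow> 'b" and W :: "'a \<Rightarrow> 'c"
  assumes D[measurable]: "D \<in> measurable M N" and W[measurable]: "W \<in> measurable M N'"
    and distr_pair: "distr M N D \<Otimes>\<^sub>M distr M N' W = distr M (N \<Otimes>\<^sub>M N') (\<lambda>\<omega>. (D \<omega>, W \<omega>))"
    and B: "B \<in> sets (N \<Otimes>\<^sub>M N')"
  shows "AE \<omega> in M. cond_prob_given M N D {\<omega> \<in> space M. (D \<omega>, W \<omega>) \<in> B} \<omega>
    = measure (distr M N' W) (Pair (D \<omega>) -` B)"
proof -
  note [measurable] = B
  interpret ND: prob_space "distr M N D" by (rule prob_space_distr) measurable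
  interpret NW: prob_space "distr M N' W" by (rule prob_space_distr) measurable
  interpret pair: pair_prob_space "distr M N D" "distr M N' W" ..
  define F where "F = vimage_algebra (space M) D N"
  define g where "g d = measure (distr M N' W) (Pair d -` B)" for d
  have D_space: "D \<in> space M \<rightarrow> space N" using measurable_space[OF D] by auto
  have sets_F: "sets F = {D -` A \<inter> space M |A. A \<in> sets N}"
    unfolding F_def by (rule sets_vimage_algebra2[OF D_space])
  have "finite_measure_subalgebra M F"
  proof
    show "subalgebra M F"
      using D by (auto simp: subalgebra_def F_def sets_F[unfolded F_def] measurable_sets)
  qed
  then interpret sigma_finite_subalgebra M F
    by (rule finite_measure_subalgebra_is_sigma_finite)
  have g_eq: "g d = enn2real (emeasure (distr M N' W) (Pair d -` B))" for d
    by (simp add: g_def measure_def)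
  have g_meas[measurable]: "g \<in> borel_measurable N"
  proof -
    have "(\<lambda>d. emeasure (distr M N' W) (Pair d -` B)) \<in> borel_measurable N"
      by (rule NW.measurable_emeasure_Pair) simp
    then show ?thesis unfolding g_eq[abs_def] by measurable
  qed
  have D_F: "D \<in> measurable F N"
    unfolding F_def by (rule measurable_vimage_algebra1[OF D_space])
  have g_bound: "norm (g d) \<le> 1" for d by (simp add: g_def)
  have "AE \<omega> in M. real_cond_exp M F (indicator {\<omega> \<in> space M. (D \<omega>, W \<omega>) \<in> B}) \<omega> = g (D \<omega>)"
  proof (rule real_cond_exp_charact)
    show "integrable M (indicator {\<omega> \<in> space M. (D \<omega>, W \<omega>) \<in> B} :: _ \<Rightarrow> real)"
      by (rule integrable_const_bound[where B = 1]) (auto simp: indicator_def)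
    show "integrable M (\<lambda>\<omega>. g (D \<omega>))"
      by (rule integrable_const_bound[where B = 1]) (use g_bound in auto)
    show "(\<lambda>\<omega>. g (D \<omega>)) \<in> borel_measurable F"
      using D_F g_meas by (rule measurable_compose)
    fix A assume "A \<in> sets F"
    then obtain A' where A'[measurable]: "A' \<in> sets N" and A: "A = D -` A' \<inter> space M"
      unfolding sets_F by blast
    \<comment> \<open>Both sides of the identity that characterizes conditional expectation on
      \<open>A\<close> are integrals of this function over the product law; Fubini connects
      them.\<close>
    define f :: "'b \<times> 'c \<Rightarrow> real" where "f z = indicator A' (fst z) * indicator B z" for z
    have f_meas[measurable]: "f \<in> borel_measurable (N \<Otimes>\<^sub>M N')"
      unfolding f_def by measurable
    have f_int: "integrable (distr M N D \<Otimes>\<^sub>M distr M N' W) f"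
      by (rule pair.P.integrable_const_bound[where B = 1]) (auto simp: f_def indicator_def)
    have slice: "(\<integral>w. f (d, w) \<partial>distr M N' W) = indicator A' d * g d" for d
    proof -
      have "(\<lambda>w. f (d, w)) = (\<lambda>w. indicator A' d * indicator (Pair d -` B) w)"
        by (auto simp: f_def indicator_def fun_eq_iff)
      moreover have "Pair d -` B \<in> sets N'" by (rule sets_Pair1[OF B])
      ultimately show ?thesis by (simp add: g_def)
    qed
    have "(\<integral>\<omega>\<in>A. indicator {\<omega> \<in> space M. (D \<omega>, W \<omega>) \<in> B} \<omega> \<partial>M) = (\<integral>\<omega>. f (D \<omega>, W \<omega>) \<partial>M)"
      unfolding set_lebesgue_integral_def
      by (intro Bochner_Integration.integral_cong) (auto simp: A f_def indicator_def)
    also have "\<dots> = integral\<^sup>L (distr M N D \<Otimes>\<^sub>M distr M N' W) f"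
      unfolding distr_pair by (rule integral_distr[symmetric]) measurable
    also have "\<dots> = (\<integral>d. \<integral>w. f (d, w) \<partial>distr M N' W \<partial>distr M N D)"
      by (rule pair.integral_fst'[OF f_int, symmetric])
    also have "\<dots> = (\<integral>\<omega>. indicator A' (D \<omega>) * g (D \<omega>) \<partial>M)"
      unfolding slice by (rule integral_distr) measurable
    also have "\<dots> = (\<integral>\<omega>\<in>A. g (D \<omega>) \<partial>M)"
      unfolding set_lebesgue_integral_def
      by (intro Bochner_Integration.integral_cong) (auto simp: A indicator_def)
    finally show "(\<integral>\<omega>\<in>A. indicator {\<omega> \<in> space M. (D \<omega>, W \<omega>) \<in> B} \<omega> \<partial>M) = (\<integral>\<omega>\<in>A. g (D \<omega>) \<partial>M)" .
  qed
  then show ?thesis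
    by (simp add: cond_prob_given_def F_def g_def)
qed

text \<open>The count is a sum of indicators with mean \<open>n * prob A\<close> and differences at
  most 1, so McDiarmid's inequality yields the one-sided Hoeffding bound.\<close>

lemma (in prob_space) prob_count_ge_le:
  assumes A[measurable]: "A \<in> events" and u: "prob A \<le> u" and s: "s > 0" and n: "n > 0"
  shows "measure (\<Pi>\<^sub>M i\<in>{..<n}. M)
      {z \<in> space (\<Pi>\<^sub>M i\<in>{..<n}. M). real n * (u + s) \<le> real (card {i. i < n \<and> z i \<in> A})}
    \<le> exp (- 2 * real n * s\<^sup>2)"
proof -
  let ?Q = "\<Pi>\<^sub>M i\<in>{..<n}. M"
  interpret Q: prob_space ?Q by (rule prob_space_PiM) unfold_locales
  define f where "f z = (\<Sum>i<n. indicator A (z i) :: real)" for z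
  have f_card: "f z = real (card {i. i < n \<and> z i \<in> A})" for z
  proof -
    have "f z = real (card ({..<n} \<inter> {i. z i \<in> A}))"
      by (simp add: f_def indicator_def sum.If_cases)
    then show ?thesis by (simp add: Int_def)
  qed
  have f_meas[measurable]: "f \<in> borel_measurable ?Q" unfolding f_def by measurable
  have comp: "integrable ?Q (\<lambda>z. indicator A (z i) :: real)" "(\<integral>z. indicator A (z i) \<partial>?Q) = prob A"
    if "i < n" for i
  proof -
    show "integrable ?Q (\<lambda>z. indicator A (z i) :: real)"
      by (rule Q.integrable_const_bound[where B = 1]) (use that in \<open>auto simp: indicator_def\<close>)
    have "(\<integral>z. indicator A (z i) \<partial>?Q) = (\<integral>x. (indicator A x :: real) \<partial>distr ?Q M (\<lambda>z. z i))"
      using that by (intro integral_distr[symmetric]) auto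
    also have "distr ?Q M (\<lambda>z. z i) = M"
      using that by (intro distr_PiM_component) (auto intro: prob_space_axioms)
    finally show "(\<integral>z. indicator A (z i) \<partial>?Q) = prob A" by simp
  qed
  have E: "integral\<^sup>L ?Q f = real n * prob A"
    unfolding f_def using comp by simp
  have diff: "\<bar>f (z(i := y)) - f z\<bar> \<le> 1" if "i \<in> {..<n}" for z i y
  proof -
    define R where "R z = (\<Sum>j\<in>{..<n} - {i}. indicator A (z j) :: real)" for z
    have "f z = indicator A (z i) + R z" for z
      unfolding f_def R_def using that by (intro sum.remove) auto
    moreover have "R (z(i := y)) = R z"
      unfolding R_def by (intro sum.cong) auto
    ultimately show ?thesis by (auto simp: indicator_def)
  qed
  have "measure ?Q {z \<in> space ?Q. f z - integral\<^sup>L ?Q f \<ge> real n * s}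
      \<le> exp (- 2 * (real n * s)\<^sup>2 / (\<Sum>i<n. 1\<^sup>2))"
    using McDiarmid[of "\<lambda>_. M" "{..<n}" "real n * s" f "\<lambda>_. 1", OF prob_space_axioms _ _ f_meas diff] s n
    by simp
  moreover have "- 2 * (real n * s)\<^sup>2 / (\<Sum>i<n. 1\<^sup>2) = - 2 * real n * s\<^sup>2"
    using n by (simp add: power2_eq_square)
  \<comment> \<open>The mean is at most \<open>n * u\<close>, so reaching \<open>n * (u + s)\<close>
    is a deviation of at least \<open>n * s\<close>.\<close>
  moreover have "measure ?Q {z \<in> space ?Q. real n * (u + s) \<le> f z}
      \<le> measure ?Q {z \<in> space ?Q. f z - integral\<^sup>L ?Q f \<ge> real n * s}"
  proof (rule Q.finite_measure_mono)
    have "integral\<^sup>L ?Q f \<le> real n * u" unfolding E using u by (intro mult_left_mono) auto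
    then show "{z \<in> space ?Q. real n * (u + s) \<le> f z} \<subseteq> {z \<in> space ?Q. f z - integral\<^sup>L ?Q f \<ge> real n * s}"
      by (auto simp: algebra_simps)
  qed measurable
  ultimately show ?thesis by (simp add: f_card)
qed

text \<open>By pigeonhole, one of the \<open>q\<close> indices below \<open>S x + r\<close> lies in
  \<open>G\<close>. So \<open>S x\<close> exceeds the least \<open>a i\<close> over \<open>G\<close>
  minus \<open>r\<close>, and the density bound prices the shift by \<open>r\<close> at
  \<open>L * r\<close>.\<close>

lemma (in prob_space) prob_exceeds_many_le:
  fixes S :: "'a \<Rightarrow> real" and a :: "nat \<Rightarrow> real"
  defines "F \<equiv> \<lambda>t. prob {x \<in> space M. S x \<le> t}"
  assumes [measurable]: "S \<in> borel_measurable M"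
    and dens: "has_density F f" and f: "\<And>t. f t \<le> L" and r: "r \<ge> 0" and u: "u \<le> 1"
    and few: "real (card {i. i < n \<and> F (a i) < u}) < q"
  shows "prob {x \<in> space M. q \<le> real (card {i. i < n \<and> a i < S x + r})} \<le> 1 - u + L * r"
proof -
  define G where "G = {i. i < n \<and> u \<le> F (a i)}"
  have L: "0 \<le> L" using dens f order_trans unfolding has_density_def by blast
  have hit: "\<exists>i\<in>G. a i < S x + r" if "q \<le> real (card {i. i < n \<and> a i < S x + r})" for x
  proof (rule ccontr)
    assume "\<not> ?thesis"
    then have "{i. i < n \<and> a i < S x + r} \<subseteq> {i. i < n \<and> F (a i) < u}"
      by (auto simp: G_def not_le[symmetric])
    then have "card {i. i < n \<and> a i < S x + r} \<le> card {i. i < n \<and> F (a i) < u}"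
      by (intro card_mono) auto
    with that few show False by linarith
  qed
  show ?thesis
  proof (cases "G = {}")
    case True
    then have "{x \<in> space M. q \<le> real (card {i. i < n \<and> a i < S x + r})} = {}"
      using hit by blast
    then show ?thesis using u L r by (simp only: measure_empty) simp
  next
    case False
    have "finite G" by (simp add: G_def)
    define v where "v = Min (a ` G)"
    have "v \<in> a ` G" unfolding v_def using False \<open>finite G\<close> by (intro Min_in) auto
    then have "u \<le> F v" by (auto simp: G_def)
    have v_le: "v \<le> a i" if "i \<in> G" for i
      unfolding v_def using \<open>finite G\<close> that by simp
    have "prob {x \<in> space M. q \<le> real (card {i. i < n \<and> a i < S x + r})}
        \<le> prob {x \<in> space M. \<not> S x \<le> v - r}"
      by (intro finite_measure_mono) (use hit v_le in \<open>force+\<close>)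
    also have "\<dots> = 1 - F (v - r)"
      unfolding F_def by (rule prob_neg) simp
    also have "F v \<le> F (v - r) + L * r"
      using dens f _ r by (rule has_density_increment_le) (simp add: F_def)
    then have "1 - F (v - r) \<le> 1 - u + L * r" using \<open>u \<le> F v\<close> by linarith
    finally show ?thesis .
  qed
qed

text \<open>Separates the test point, stored at index \<open>n\<close>, from the training points.
  The large product is the image of a pair under insertion at \<open>n\<close>, and splitting undoes
  the insertion up to a swap.\<close>

lemma distr_PiM_split_last:
  fixes n :: nat
  assumes P: "prob_space P"
  shows "distr (\<Pi>\<^sub>M i\<in>{..n}. P) ((\<Pi>\<^sub>M i\<in>{..<n}. P) \<Otimes>\<^sub>M P) (\<lambda>z. (restrict z {..<n}, z n))
    = (\<Pi>\<^sub>M i\<in>{..<n}. P) \<Otimes>\<^sub>M P"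
proof -
  let ?Q = "\<Pi>\<^sub>M i\<in>{..<n}. P"
  interpret P: prob_space P by (rule P)
  interpret Q: prob_space ?Q by (rule prob_space_PiM) (rule P)
  interpret QP: pair_prob_space ?Q P ..
  have insert: "{..n} = insert n {..<n}" by auto
  have upd: "(\<lambda>(x, X). X(n := x)) \<in> measurable (P \<Otimes>\<^sub>M ?Q) (\<Pi>\<^sub>M i\<in>{..n}. P)"
    unfolding case_prod_beta by (rule measurable_fun_upd[where J = "{..<n}"]) auto
  have split: "(\<lambda>z. (restrict z {..<n}, z n)) \<in> measurable (\<Pi>\<^sub>M i\<in>{..n}. P) (?Q \<Otimes>\<^sub>M P)"
    by (intro measurable_Pair measurable_restrict_subset measurable_component_singleton) auto
  have "(\<Pi>\<^sub>M i\<in>{..n}. P) = distr (P \<Otimes>\<^sub>M ?Q) (\<Pi>\<^sub>M i\<in>{..n}. P) (\<lambda>(x, X). X(n := x))"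
    unfolding insert by (rule distr_pair_PiM_eq_PiM[symmetric]) (auto intro: P)
  then have "distr (\<Pi>\<^sub>M i\<in>{..n}. P) (?Q \<Otimes>\<^sub>M P) (\<lambda>z. (restrict z {..<n}, z n))
    = distr (distr (P \<Otimes>\<^sub>M ?Q) (\<Pi>\<^sub>M i\<in>{..n}. P) (\<lambda>(x, X). X(n := x)))
        (?Q \<Otimes>\<^sub>M P) (\<lambda>z. (restrict z {..<n}, z n))"
    by (rule arg_cong)
  also have "\<dots> = distr (P \<Otimes>\<^sub>M ?Q) (?Q \<Otimes>\<^sub>M P) ((\<lambda>z. (restrict z {..<n}, z n)) \<circ> (\<lambda>(x, X). X(n := x)))"
    by (rule distr_distr[OF split upd])
  also have "\<dots> = distr (P \<Otimes>\<^sub>M ?Q) (?Q \<Otimes>\<^sub>M P) (\<lambda>(x, X). (X, x))"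
    by (rule distr_cong)
      (auto simp: space_pair_measure space_PiM fun_eq_iff PiE_def extensional_def restrict_def)
  also have "\<dots> = ?Q \<Otimes>\<^sub>M P"
    by (rule QP.distr_pair_swap[symmetric])
  finally show ?thesis .
qed

section \<open>Stable models\<close>

lemma delete_nth_map_upt:
  assumes "i < n"
  shows "delete_nth i (map z [0..<n]) = map (\<lambda>j. z (if j < i then j else Suc j)) [0..<n - 1]"
  using assms by (intro nth_equalityI) (auto simp: delete_nth_def nth_append)

text \<open>The reason for taking the last leave-one-out fit as reference: its data form an initial
  segment, whose law is a marginal of the product without any reindexing.\<close>

lemma delete_nth_last_map_upt: "0 < n \<Longrightarrow> delete_nth (n - 1) (map z [0..<n]) = map z [0..<n - 1]"
  by (simp add: delete_nth_map_upt)

lemma length_delete_nth: "i < length zs \<Longrightarrow> length (delete_nth i zs) = length zs - 1"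
  by (auto simp: delete_nth_def)

lemma nth_delete_nth:
  "i < length zs \<Longrightarrow> k < length zs - 1 \<Longrightarrow> delete_nth i zs ! k = zs ! (if k < i then k else Suc k)"
  by (auto simp: delete_nth_def nth_append)

text \<open>Gives the common part of two leave-one-out data sets; deleting the earlier position
  first moves the later one down by 1.\<close>

lemma delete_nth_twice:
  assumes "i < j" "j < length zs"
  shows "delete_nth (j - 1) (delete_nth i zs) = delete_nth i (delete_nth j zs)"
proof (rule nth_equalityI)
  fix k assume "k < length (delete_nth (j - 1) (delete_nth i zs))"
  then have "k < length zs - 2" using assms by (simp add: length_delete_nth)
  then show "delete_nth (j - 1) (delete_nth i zs) ! k = delete_nth i (delete_nth j zs) ! k"
    using assms by (simp add: nth_delete_nth length_delete_nth) linarith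
qed (use assms in \<open>simp add: length_delete_nth\<close>)

lemma map_restrict_upt: "map (restrict g {..<k}) [0..<k] = map g [0..<k]"
  by (intro map_cong) auto

lemma set_delete_nth_subset: "set (delete_nth i zs) \<subseteq> set zs"
  using set_take_subset set_drop_subset by (fastforce simp: delete_nth_def)

lemma delete_nth_upd:
  assumes "i < k"
  shows "delete_nth i (map (z(i := y)) [0..<k]) = delete_nth i (map z [0..<k])"
  using assms by (auto simp: delete_nth_map_upt)

text \<open>Boundedness matters: the real supremum of an unbounded set carries no
  information.\<close>

lemma sup_norm_ge:
  assumes "bounded (f ` space SX)" "x \<in> space SX"
  shows "\<bar>f x\<bar> \<le> sup_norm SX f"
proof -
  have "bounded ((\<lambda>x. \<bar>f x\<bar>) ` space SX)"
    using assms(1) by (auto simp: bounded_iff)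
  then show ?thesis
    unfolding sup_norm_def by (intro cSUP_upper assms bounded_imp_bdd_above)
qed

text \<open>Collects what is assumed of the model, the algorithm and the data law. The density bound
  is instead a hypothesis of the lemmas that use it, for the one sample size
  \<open>n - 1\<close>.\<close>

locale stable_model =
  fixes SX :: "'x measure" and Y :: "real set"
    and \<mu> :: "real ^ 'p \<Rightarrow> 'x \<Rightarrow> real"
    and T :: "('x \<times> real) list \<Rightarrow> real ^ 'p"
    and c :: "nat \<Rightarrow> real" and \<kappa>\<^sub>1 \<kappa>\<^sub>2 :: real
    and P :: "('x \<times> real) measure"
  assumes \<mu>_measurable: "\<And>\<beta>. \<mu> \<beta> \<in> borel_measurable SX"
    and \<mu>_bounded: "\<And>\<beta>. bounded (\<mu> \<beta> ` space SX)"
    and T: "training_algorithm SX Y T"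
    and prob_P: "prob_space P" and sets_P: "sets P = sets (data_space SX Y)"
    and c_pos: "\<And>k. k \<ge> 1 \<Longrightarrow> c k > 0"
    and A1: "\<And>k zs i. k \<ge> 2 \<Longrightarrow> length zs = k \<Longrightarrow> set zs \<subseteq> space SX \<times> Y \<Longrightarrow> i < k \<Longrightarrow>
          sup_norm SX (\<lambda>x. \<mu> (T (delete_nth i zs)) x - \<mu> (T zs) x) \<le> c k / 2"
    and \<kappa>\<^sub>1_pos: "\<kappa>\<^sub>1 > 0"
    and A2: "\<And>\<beta> \<beta>'. \<kappa>\<^sub>1 * infnorm (\<beta> - \<beta>') \<le> sup_norm SX (\<lambda>x. \<mu> \<beta> x - \<mu> \<beta>' x)"
            "\<And>\<beta> \<beta>'. sup_norm SX (\<lambda>x. \<mu> \<beta> x - \<mu> \<beta>' x) \<le> \<kappa>\<^sub>2 * infnorm (\<beta> - \<beta>')"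
begin

section \<open>Regularity of the model\<close>

sublocale P: prob_space P by (rule prob_P)

abbreviation Q :: "nat \<Rightarrow> (nat \<Rightarrow> 'x \<times> real) measure" where
  "Q k \<equiv> \<Pi>\<^sub>M i\<in>{..<k}. P"

sublocale Q: prob_space "Q k" for k
  by (rule prob_space_PiM) (rule prob_P)

text \<open>The residual for the deterministic predictor; \<open>resid_cdf\<close> is its
  distribution function.\<close>

definition mean_resid :: "nat \<Rightarrow> 'x \<times> real \<Rightarrow> real" where
  "mean_resid k w = \<bar>snd w - \<mu> (mean_param P T k) (fst w)\<bar>"

lemma sets_P_pair: "sets P = sets (SX \<Otimes>\<^sub>M restrict_space borel Y)"
  by (simp add: sets_P data_space_def)

lemma space_P: "space P = space SX \<times> Y"
  using sets_eq_imp_space_eq[OF sets_P_pair] by (simp add: space_pair_measure space_restrict_space)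

lemma space_SX_nonempty: "space SX \<noteq> {}"
  using P.not_empty by (auto simp: space_P)

lemma fst_P[measurable]: "fst \<in> measurable P SX"
  unfolding measurable_cong_sets[OF sets_P_pair refl] by (rule measurable_fst)

lemma snd_P[measurable]: "snd \<in> borel_measurable P"
  unfolding measurable_cong_sets[OF sets_P_pair refl]
  by (rule measurable_compose[OF measurable_snd measurable_restrict_space1]) simp

lemma bounded_diff: "bounded ((\<lambda>x. \<mu> \<beta> x - \<mu> \<beta>' x) ` space SX)"
  by (intro bounded_minus_comp \<mu>_bounded)

lemma lipschitz:
  assumes "x \<in> space SX"
  shows "\<bar>\<mu> \<beta> x - \<mu> \<beta>' x\<bar> \<le> \<kappa>\<^sub>2 * infnorm (\<beta> - \<beta>')"
  using sup_norm_ge[OF bounded_diff assms] A2(2) by (rule order_trans)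

text \<open>The type \<open>'p\<close> is nonempty, so there are two distinct parameters; on them
  \<open>A2\<close> forces \<open>\<kappa>\<^sub>1 \<le> \<kappa>\<^sub>2\<close>.\<close>

lemma \<kappa>\<^sub>2_pos: "\<kappa>\<^sub>2 > 0"
proof -
  define e :: "real ^ 'p" where "e = (\<chi> j. 1)"
  have "e \<noteq> 0" by (simp add: e_def vec_eq_iff)
  then have "infnorm e > 0" by (simp add: infnorm_pos_lt)
  moreover have "\<kappa>\<^sub>1 * infnorm e \<le> \<kappa>\<^sub>2 * infnorm e"
    using A2(1)[of e 0] A2(2)[of e 0] by simp
  ultimately show ?thesis using \<kappa>\<^sub>1_pos by simp
qed

text \<open>Predictions are made at data-dependent parameters, so measurability at each fixed
  parameter does not suffice.\<close>

lemma jointly_measurable: "(\<lambda>(\<beta>, x). \<mu> \<beta> x) \<in> borel_measurable (borel \<Otimes>\<^sub>M SX)"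
proof (rule borel_measurable_lipschitz_family)
  fix \<beta> \<beta>' x assume "x \<in> space SX"
  then have "\<bar>\<mu> \<beta> x - \<mu> \<beta>' x\<bar> \<le> \<kappa>\<^sub>2 * infnorm (\<beta> - \<beta>')" by (rule lipschitz)
  also have "\<dots> \<le> \<kappa>\<^sub>2 * norm (\<beta> - \<beta>')"
    using \<kappa>\<^sub>2_pos by (intro mult_left_mono infnorm_le_norm) simp
  finally show "\<bar>\<mu> \<beta> x - \<mu> \<beta>' x\<bar> \<le> \<kappa>\<^sub>2 * norm (\<beta> - \<beta>')" .
qed (rule \<mu>_measurable)

lemma measurable_predict:
  assumes [measurable]: "b \<in> borel_measurable N" "g \<in> measurable N SX"
  shows "(\<lambda>z. \<mu> (b z) (g z)) \<in> borel_measurable N"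
proof -
  have "(\<lambda>z. (b z, g z)) \<in> measurable N (borel \<Otimes>\<^sub>M SX)" by measurable
  from measurable_compose[OF this jointly_measurable] show ?thesis by simp
qed

lemma mean_resid_measurable[measurable]: "mean_resid k \<in> borel_measurable P"
  unfolding mean_resid_def[abs_def]
  by (intro borel_measurable_abs borel_measurable_diff snd_P measurable_predict fst_P) simp

lemma resid_cdf_eq: "resid_cdf P \<mu> T k t = P.prob {w \<in> space P. mean_resid k w \<le> t}"
  by (auto simp: resid_cdf_def mean_resid_def case_prod_beta intro!: arg_cong[where f = P.prob])

section \<open>Stability of the fitted parameter\<close>

text \<open>
  Comparing through the common data set with one more point removed spares any symmetry assumption
  on \<open>T\<close>.
\<close>

lemma param_dist_of_delete_eq:
  assumes k: "k \<ge> 2" and len: "length zs = k" "length zs' = k"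
    and data: "set zs \<subseteq> space SX \<times> Y" "set zs' \<subseteq> space SX \<times> Y"
    and ij: "i < k" "j < k" and eq: "delete_nth i zs = delete_nth j zs'"
  shows "infnorm (T zs - T zs') \<le> c k / \<kappa>\<^sub>1"
proof -
  \<comment> \<open>Two applications of \<open>A1\<close>, each costing \<open>c k / 2\<close>, meet
    at the fit on the common smaller data set.\<close>
  have "\<bar>\<mu> (T zs) x - \<mu> (T zs') x\<bar> \<le> c k" if x: "x \<in> space SX" for x
    using sup_norm_ge[OF bounded_diff x, of "T (delete_nth i zs)" "T zs"]
      sup_norm_ge[OF bounded_diff x, of "T (delete_nth j zs')" "T zs'"]
      A1[OF k len(1) data(1) ij(1)] A1[OF k len(2) data(2) ij(2)] eq by simp
  then have "sup_norm SX (\<lambda>x. \<mu> (T zs) x - \<mu> (T zs') x) \<le> c k"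
    unfolding sup_norm_def using space_SX_nonempty by (intro cSUP_least)
  with A2(1)[of "T zs" "T zs'"] have "\<kappa>\<^sub>1 * infnorm (T zs - T zs') \<le> c k" by simp
  then show ?thesis using \<kappa>\<^sub>1_pos by (simp add: field_simps)
qed

lemma set_data: "z \<in> space (Q k) \<Longrightarrow> set (map z [0..<k]) \<subseteq> space SX \<times> Y"
  by (auto simp: space_PiM PiE_def Pi_def space_P[symmetric])

text \<open>Supplies the differences for McDiarmid's inequality: old and new data agree once
  position \<open>i\<close> is deleted.\<close>

lemma param_replace_one:
  assumes "k \<ge> 2" and z: "z \<in> space (Q k)" and i: "i < k" and y: "y \<in> space P"
  shows "infnorm (T (map (z(i := y)) [0..<k]) - T (map z [0..<k])) \<le> c k / \<kappa>\<^sub>1"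
proof (rule param_dist_of_delete_eq[where i = i and j = i])
  have "z(i := y) \<in> space (Q k)"
    using z i y by (auto simp: space_PiM PiE_def extensional_def)
  then show "set (map (z(i := y)) [0..<k]) \<subseteq> space SX \<times> Y" by (rule set_data)
qed (use assms set_data[OF z] in \<open>auto simp: delete_nth_upd simp del: set_map\<close>)

text \<open>Two leave-one-out data sets agree after each also loses the point missing from the
  other. They have \<open>n - 1\<close> points, and \<open>n \<ge> 3\<close> makes this at least the
  2 required for stability.\<close>

lemma loo_param_dist:
  assumes n: "n \<ge> 3" and z: "z \<in> space (Q n)" and ij: "i < n" "j < n"
  shows "infnorm (T (delete_nth i (map z [0..<n])) - T (delete_nth j (map z [0..<n]))) \<le> c (n - 1) / \<kappa>\<^sub>1"
proof -
  let ?zs = "map z [0..<n]"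
  have less: "infnorm (T (delete_nth i ?zs) - T (delete_nth j ?zs)) \<le> c (n - 1) / \<kappa>\<^sub>1"
    if "i < j" "j < n" for i j
  proof (rule param_dist_of_delete_eq[where i = "j - 1" and j = i])
    show "set (delete_nth i ?zs) \<subseteq> space SX \<times> Y" "set (delete_nth j ?zs) \<subseteq> space SX \<times> Y"
      using set_delete_nth_subset set_data[OF z] by (rule order_trans)+
  qed (use that n delete_nth_twice[of i j ?zs] in \<open>auto simp: length_delete_nth\<close>)
  \<comment> \<open>For the case \<open>i = j\<close>, where the distance is 0.\<close>
  have "0 \<le> c (n - 1) / \<kappa>\<^sub>1" using c_pos[of "n - 1"] n \<kappa>\<^sub>1_pos by (intro divide_nonneg_pos less_imp_le) auto
  then show ?thesis
    using less[of i j] less[of j i] ij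
    by (cases i j rule: linorder_cases) (auto simp: infnorm_sub infnorm_0)
qed

section \<open>Measurability of the fitted parameters\<close>

lemma T_measurable:
  assumes "k \<ge> 1"
  shows "(\<lambda>z. T (map z [0..<k])) \<in> borel_measurable (Q k)"
proof -
  have "sets (Q k) = sets (\<Pi>\<^sub>M i\<in>{..<k}. data_space SX Y)"
    by (intro sets_PiM_cong) (auto simp: sets_P)
  then show ?thesis
    using T assms measurable_cong_sets[of "Q k" "\<Pi>\<^sub>M i\<in>{..<k}. data_space SX Y"]
    unfolding training_algorithm_def by blast
qed

text \<open>Deleting a point reindexes coordinates, so this is the fit on \<open>n - 1\<close>
  points composed with a measurable map.\<close>

lemma loo_T_measurable:
  assumes "n \<ge> 2" "i < n"
  shows "(\<lambda>z. T (delete_nth i (map z [0..<n]))) \<in> borel_measurable (Q n)"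
proof -
  have "(\<lambda>z. \<lambda>j\<in>{..<n - 1}. z (if j < i then j else Suc j)) \<in> measurable (Q n) (Q (n - 1))"
    using assms by (intro measurable_restrict measurable_component_singleton) auto
  from measurable_compose[OF this T_measurable]
  have "(\<lambda>z. T (map (\<lambda>j\<in>{..<n - 1}. z (if j < i then j else Suc j)) [0..<n - 1])) \<in> borel_measurable (Q n)"
    using assms by simp
  then show ?thesis
    unfolding map_restrict_upt delete_nth_map_upt[OF assms(2)] .
qed

section \<open>Concentration of the fitted parameter\<close>

lemma param_concentration:
  assumes k: "k \<ge> 2" and t: "t > 0"
  shows "measure (Q k) {z \<in> space (Q k). infnorm (T (map z [0..<k]) - mean_param P T k) > t}
    \<le> 2 * real CARD('p) * exp (- 2 * t\<^sup>2 / (real k * (c k / \<kappa>\<^sub>1)\<^sup>2))"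
proof -
  let ?E = "exp (- 2 * t\<^sup>2 / (real k * (c k / \<kappa>\<^sub>1)\<^sup>2))"
  define f where "f j z = T (map z [0..<k]) $ j" for j z
  define m where "m j = (\<integral>z. f j z \<partial>Q k)" for j
  have b: "c k / \<kappa>\<^sub>1 > 0" using c_pos[of k] k \<kappa>\<^sub>1_pos by simp
  have meas[measurable]: "f j \<in> borel_measurable (Q k)" for j
    unfolding f_def
    by (rule measurable_compose[OF T_measurable]) (use k in \<open>auto intro!: borel_measurable_continuous_onI continuous_intros\<close>)
  have diff: "\<bar>f j (z(i := y)) - f j z\<bar> \<le> c k / \<kappa>\<^sub>1"
    if "z \<in> space (Q k)" "i \<in> {..<k}" "y \<in> space P" for j z i y
  proof -
    have "\<bar>(T (map (z(i := y)) [0..<k]) - T (map z [0..<k])) $ j\<bar> \<le> c k / \<kappa>\<^sub>1"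
      using param_replace_one[OF k that(1) _ that(3)] that(2) unfolding infnorm_le_iff by blast
    then show ?thesis by (simp add: f_def)
  qed
  have sum: "(\<Sum>i<k. (c k / \<kappa>\<^sub>1)\<^sup>2) = real k * (c k / \<kappa>\<^sub>1)\<^sup>2" by simp
  have pos: "real k * (c k / \<kappa>\<^sub>1)\<^sup>2 > 0"
    using k b by (intro mult_pos_pos zero_less_power) auto
  \<comment> \<open>Every coordinate of the fit has differences at most
    \<open>c k / \<kappa>\<^sub>1\<close>. The two tails, united over all coordinates, give the
    factor \<open>2 * CARD('p)\<close>.\<close>
  have upper: "Q.prob k {z \<in> space (Q k). f j z - m j \<ge> t} \<le> ?E" for j
    using McDiarmid[of "\<lambda>_. P" "{..<k}" t "f j" "\<lambda>_. c k / \<kappa>\<^sub>1", OF prob_P _ t meas diff] pos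
    unfolding sum m_def by simp
  have lower: "Q.prob k {z \<in> space (Q k). - f j z + m j \<ge> t} \<le> ?E" for j
    using McDiarmid[of "\<lambda>_. P" "{..<k}" t "\<lambda>z. - f j z" "\<lambda>_. c k / \<kappa>\<^sub>1", OF prob_P _ t] meas diff pos
    unfolding sum m_def by (simp add: abs_minus_commute)
  have "Q.prob k {z \<in> space (Q k). infnorm (T (map z [0..<k]) - mean_param P T k) > t}
    \<le> Q.prob k (\<Union>j. {z \<in> space (Q k). f j z - m j \<ge> t} \<union> {z \<in> space (Q k). - f j z + m j \<ge> t})"
  proof (rule Q.finite_measure_mono)
    have "\<exists>j. f j z - m j \<ge> t \<or> - f j z + m j \<ge> t"
      if large: "infnorm (T (map z [0..<k]) - mean_param P T k) > t" for z
    proof -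
      obtain j where "\<bar>(T (map z [0..<k]) - mean_param P T k) $ j\<bar> > t"
        using large infnorm_le_iff by (meson not_le)
      then have "\<bar>f j z - m j\<bar> > t" by (simp add: f_def m_def mean_param_def)
      then show ?thesis by (intro exI[of _ j]) linarith
    qed
    then show "{z \<in> space (Q k). infnorm (T (map z [0..<k]) - mean_param P T k) > t}
      \<subseteq> (\<Union>j. {z \<in> space (Q k). f j z - m j \<ge> t} \<union> {z \<in> space (Q k). - f j z + m j \<ge> t})"
      by blast
  qed measurable
  also have "\<dots> \<le> (\<Sum>j\<in>UNIV. Q.prob k ({z \<in> space (Q k). f j z - m j \<ge> t} \<union> {z \<in> space (Q k). - f j z + m j \<ge> t}))"
    by (rule Q.finite_measure_subadditive_finite) auto
  also have "\<dots> \<le> (\<Sum>j\<in>(UNIV :: 'p set). ?E + ?E)"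
    by (intro sum_mono order_trans[OF measure_Un_le] add_mono upper lower) auto
  also have "\<dots> = 2 * real CARD('p) * ?E" by simp
  finally show ?thesis .
qed

text \<open>The first \<open>n - 1\<close> of \<open>n\<close> independent points follow the smaller
  product law, for which the concentration bound is known.\<close>

lemma loo_param_concentration:
  assumes n: "n \<ge> 3" and t: "t > 0"
  shows "measure (Q n) {z \<in> space (Q n).
      infnorm (T (delete_nth (n - 1) (map z [0..<n])) - mean_param P T (n - 1)) > t}
    \<le> 2 * real CARD('p) * exp (- 2 * t\<^sup>2 / (real (n - 1) * (c (n - 1) / \<kappa>\<^sub>1)\<^sup>2))"
proof -
  define k where "k = n - 1"
  interpret product_prob_space "\<lambda>_. P" "{..<n}" by (intro product_prob_spaceI prob_P)
  define B where "B = {z \<in> space (Q k). infnorm (T (map z [0..<k]) - mean_param P T k) > t}"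
  have restr: "Q k = distr (Q n) (Q k) (\<lambda>z. restrict z {..<k})"
    by (rule distr_restrict) (auto simp: k_def)
  have restr_meas: "(\<lambda>z. restrict z {..<k}) \<in> measurable (Q n) (Q k)"
    by (rule measurable_restrict_subset) (auto simp: k_def)
  have inf_meas: "infnorm \<in> borel_measurable (borel :: (real ^ 'p) measure)"
    by (intro borel_measurable_continuous_onI continuous_intros)
  have [measurable]: "B \<in> sets (Q k)"
  proof -
    have [measurable]: "(\<lambda>z. infnorm (T (map z [0..<k]) - mean_param P T k)) \<in> borel_measurable (Q k)"
      by (rule measurable_compose[OF _ inf_meas])
        (intro borel_measurable_diff T_measurable, use n in \<open>auto simp: k_def\<close>)
    show ?thesis unfolding B_def by measurable
  qed
  have "{z \<in> space (Q n). infnorm (T (delete_nth (n - 1) (map z [0..<n])) - mean_param P T (n - 1)) > t}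
    = (\<lambda>z. restrict z {..<k}) -` B \<inter> space (Q n)"
  proof -
    have "restrict z {..<k} \<in> space (Q k)" if "z \<in> space (Q n)" for z
      using restr_meas that by (rule measurable_space)
    moreover have "delete_nth (n - 1) (map z [0..<n]) = map z [0..<k]" for z :: "nat \<Rightarrow> 'x \<times> real"
      using n unfolding k_def by (intro delete_nth_last_map_upt) simp
    ultimately show ?thesis
      unfolding B_def k_def[symmetric] by (simp add: set_eq_iff map_restrict_upt) blast
  qed
  also have "measure (Q n) \<dots> = measure (distr (Q n) (Q k) (\<lambda>z. restrict z {..<k})) B"
    by (rule measure_distr[OF restr_meas \<open>B \<in> sets (Q k)\<close>, symmetric])
  also have "\<dots> = measure (Q k) B"
    by (simp only: restr[symmetric])
  also have "\<dots> \<le> 2 * real CARD('p) * exp (- 2 * t\<^sup>2 / (real k * (c k / \<kappa>\<^sub>1)\<^sup>2))"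
    unfolding B_def by (rule param_concentration) (use n t in \<open>auto simp: k_def\<close>)
  finally show ?thesis by (simp add: k_def)
qed

section \<open>The miss event and its conditional probability\<close>

lemma sets_miss:
  assumes "n \<ge> 2" "\<alpha> < 1"
  shows "{v \<in> space (Q n \<Otimes>\<^sub>M P). snd (snd v) \<notin> jackknife_plus \<mu> T \<alpha> (map (fst v) [0..<n]) (fst (snd v))}
    \<in> sets (Q n \<Otimes>\<^sub>M P)"
proof -
  let ?N = "Q n \<Otimes>\<^sub>M P"
  define p where "p i v = \<mu> (T (delete_nth i (map (fst v) [0..<n]))) (fst (snd v))" for i and v :: "(nat \<Rightarrow> 'x \<times> real) \<times> 'x \<times> real"
  define r where "r i v = loo_resid \<mu> T (map (fst v) [0..<n]) i" for i and v :: "(nat \<Rightarrow> 'x \<times> real) \<times> 'x \<times> real"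
  have b: "(\<lambda>v. T (delete_nth i (map (fst v) [0..<n]))) \<in> borel_measurable ?N" if "i < n" for i
    by (rule measurable_compose[OF measurable_fst loo_T_measurable]) (use assms that in auto)
  have comp: "(\<lambda>v. fst v i) \<in> measurable ?N P" if "i < n" for i
    using that by (intro measurable_compose[OF measurable_fst] measurable_component_singleton) auto
  have p[measurable]: "p i \<in> borel_measurable ?N" if "i < n" for i
    unfolding p_def[abs_def] by (rule measurable_predict[OF b[OF that]]) measurable
  have r[measurable]: "r i \<in> borel_measurable ?N" if "i < n" for i
  proof -
    have "r i = (\<lambda>v. \<bar>snd (fst v i) - \<mu> (T (delete_nth i (map (fst v) [0..<n]))) (fst (fst v i))\<bar>)"
      using that by (auto simp: r_def loo_resid_def fun_eq_iff)
    also have "\<dots> \<in> borel_measurable ?N"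
      by (intro borel_measurable_abs borel_measurable_diff measurable_predict b that
          measurable_compose[OF comp snd_P] measurable_compose[OF comp fst_P])
    finally show ?thesis .
  qed
  \<comment> \<open>A count is measurable once each comparison is. For \<open>i \<ge> n\<close> the
    set is empty, which matters because \<open>p i\<close> and \<open>r i\<close> are controlled
    only for \<open>i < n\<close>.\<close>
  have [measurable]: "(\<lambda>v. card {i. i < n \<and> snd (snd v) < p i v - r i v}) \<in> measurable ?N (count_space UNIV)"
  proof (rule measurable_card)
    fix i
    show "{v \<in> space ?N. i \<in> {i. i < n \<and> snd (snd v) < p i v - r i v}} \<in> sets ?N"
      by (cases "i < n") auto
  qed
  have [measurable]: "(\<lambda>v. card {i. i < n \<and> p i v + r i v < snd (snd v)}) \<in> measurable ?N (count_space UNIV)"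
  proof (rule measurable_card)
    fix i
    show "{v \<in> space ?N. i \<in> {i. i < n \<and> p i v + r i v < snd (snd v)}} \<in> sets ?N"
      by (cases "i < n") auto
  qed
  show ?thesis
    unfolding notin_jackknife_plus_iff[OF \<open>\<alpha> < 1\<close>] length_map length_upt diff_zero p_def[symmetric] r_def[symmetric]
    by measurable
qed

text \<open>The training data are fixed and only the test point is random; \<open>close\<close> and
  \<open>few\<close> are the two good events, whose probabilities are estimated separately.\<close>

lemma miscoverage_le:
  assumes n: "n \<ge> 3" and \<alpha>: "\<alpha> < 1" and z: "z \<in> space (Q n)"
    and close: "infnorm (T (delete_nth (n - 1) (map z [0..<n])) - mean_param P T (n - 1)) \<le> t"
    and dens: "has_density (resid_cdf P \<mu> T (n - 1)) f" and f: "\<And>s. f s \<le> L"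
    and few: "real (card {i. i < n \<and> resid_cdf P \<mu> T (n - 1) (mean_resid (n - 1) (z i)) < u})
      < (1 - \<alpha>) * real n" and u: "u \<le> 1"
  shows "P.prob {w \<in> space P. snd w \<notin> jackknife_plus \<mu> T \<alpha> (map z [0..<n]) (fst w)}
    \<le> 1 - u + L * (2 * (\<kappa>\<^sub>2 * (c (n - 1) / \<kappa>\<^sub>1 + t)))"
proof -
  \<comment> \<open>The distance from any leave-one-out parameter to the last one, plus the distance
    from there to the mean, scaled by the Lipschitz constant.\<close>
  define \<Delta> where "\<Delta> = \<kappa>\<^sub>2 * (c (n - 1) / \<kappa>\<^sub>1 + t)"
  define S where "S = mean_resid (n - 1)"
  let ?\<beta> = "mean_param P T (n - 1)"
  have z_i: "z i \<in> space SX \<times> Y" if "i < n" for i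
    using z that by (auto simp: space_PiM space_P[symmetric])
  have near: "\<bar>\<mu> (T (delete_nth i (map z [0..<n]))) x - \<mu> ?\<beta> x\<bar> \<le> \<Delta>"
    if i: "i < n" and x: "x \<in> space SX" for i x
  proof -
    let ?b = "\<lambda>i. T (delete_nth i (map z [0..<n]))"
    have "infnorm (?b i - ?\<beta>) = infnorm ((?b i - ?b (n - 1)) + (?b (n - 1) - ?\<beta>))" by simp
    also have "\<dots> \<le> infnorm (?b i - ?b (n - 1)) + infnorm (?b (n - 1) - ?\<beta>)"
      by (rule infnorm_triangle)
    also have "\<dots> \<le> c (n - 1) / \<kappa>\<^sub>1 + t"
      using loo_param_dist[OF n z i, of "n - 1"] n close by (intro add_mono) auto
    finally have "\<kappa>\<^sub>2 * infnorm (?b i - ?\<beta>) \<le> \<Delta>"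
      unfolding \<Delta>_def using \<kappa>\<^sub>2_pos by (intro mult_left_mono) auto
    with lipschitz[OF x, of "?b i" ?\<beta>] show ?thesis by linarith
  qed
  \<comment> \<open>An absolute value is below \<open>\<Delta>\<close> at any point of the nonempty
    input space.\<close>
  have "0 \<le> \<Delta>"
    using near[of 0] n space_SX_nonempty by (meson abs_ge_zero all_not_in_conv less_le_trans order_trans zero_less_numeral)
  have "P.prob {w \<in> space P. snd w \<notin> jackknife_plus \<mu> T \<alpha> (map z [0..<n]) (fst w)}
    \<le> P.prob {w \<in> space P. (1 - \<alpha>) * real n \<le> real (card {i. i < n \<and> S (z i) < S w + 2 * \<Delta>})}"
  proof (rule P.finite_measure_mono)
    have "(1 - \<alpha>) * real n \<le> real (card {i. i < n \<and> S (z i) < S w + 2 * \<Delta>})"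
      if w: "w \<in> space P" and miss: "snd w \<notin> jackknife_plus \<mu> T \<alpha> (map z [0..<n]) (fst w)" for w
    proof -
      have "(1 - \<alpha>) * real (length (map z [0..<n])) \<le> real (card {i. i < length (map z [0..<n]) \<and>
          \<bar>snd (map z [0..<n] ! i) - \<mu> ?\<beta> (fst (map z [0..<n] ! i))\<bar> < \<bar>snd w - \<mu> ?\<beta> (fst w)\<bar> + 2 * \<Delta>})"
      proof (rule jackknife_plus_miss_count[OF \<alpha> _ _ _ miss])
        show "fst w \<in> space SX" using w by (auto simp: space_P)
        show "fst (map z [0..<n] ! i) \<in> space SX" if "i < length (map z [0..<n])" for i
          using z_i[of i] that by auto
      qed (use near in auto)
      also have "{i. i < length (map z [0..<n]) \<and>
          \<bar>snd (map z [0..<n] ! i) - \<mu> ?\<beta> (fst (map z [0..<n] ! i))\<bar> < \<bar>snd w - \<mu> ?\<beta> (fst w)\<bar> + 2 * \<Delta>}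
        = {i. i < n \<and> S (z i) < S w + 2 * \<Delta>}"
        by (auto simp: S_def mean_resid_def)
      finally show ?thesis by simp
    qed
    then show "{w \<in> space P. snd w \<notin> jackknife_plus \<mu> T \<alpha> (map z [0..<n]) (fst w)}
      \<subseteq> {w \<in> space P. (1 - \<alpha>) * real n \<le> real (card {i. i < n \<and> S (z i) < S w + 2 * \<Delta>})}"
      by blast
    have [measurable]: "S \<in> borel_measurable P" by (simp add: S_def)
    have [measurable]: "(\<lambda>w. card {i. i < n \<and> S (z i) < S w + 2 * \<Delta>}) \<in> measurable P (count_space UNIV)"
      by (rule measurable_card) simp
    show "{w \<in> space P. (1 - \<alpha>) * real n \<le> real (card {i. i < n \<and> S (z i) < S w + 2 * \<Delta>})} \<in> P.events"
      by measurable
  qed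
  also have "\<dots> \<le> 1 - u + L * (2 * \<Delta>)"
  proof (rule P.prob_exceeds_many_le)
    have cdf: "resid_cdf P \<mu> T (n - 1) = (\<lambda>t. P.prob {w \<in> space P. S w \<le> t})"
      by (simp add: fun_eq_iff resid_cdf_eq S_def)
    show "has_density (\<lambda>t. P.prob {w \<in> space P. S w \<le> t}) f" using dens by (simp only: cdf)
    show "real (card {i. i < n \<and> P.prob {w \<in> space P. S w \<le> S (z i)} < u}) < (1 - \<alpha>) * real n"
      using few unfolding resid_cdf_eq S_def .
    show "S \<in> borel_measurable P" by (simp add: S_def)
  qed (use f u \<open>0 \<le> \<Delta>\<close> in auto)
  finally show ?thesis by (simp only: \<Delta>_def)
qed

text \<open>\<open>N1\<close> and \<open>N2\<close> are the failures of the two good events: a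
  parameter far from its mean, and too many residuals below the level \<open>u\<close>. They take
  the shares \<open>\<epsilon>\<close> and \<open>\<delta>\<close> of the probability.\<close>

lemma miscoverage_exceptional_set:
  fixes \<epsilon> \<delta> \<alpha> L :: real
  assumes n: "n \<ge> 3" and \<alpha>: "0 < \<alpha>" "\<alpha> < 1" and \<epsilon>: "0 < \<epsilon>" "\<epsilon> < 1" and \<delta>: "0 < \<delta>" "\<delta> < 1"
    and dens: "has_density (resid_cdf P \<mu> T (n - 1)) f" and f: "\<And>s. f s \<le> L"
  obtains N where "N \<in> sets (Q n)" "Q.prob n N \<le> \<epsilon> + \<delta>"
    "\<And>z. z \<in> space (Q n) \<Longrightarrow> z \<notin> N \<Longrightarrow>
      P.prob {w \<in> space P. snd w \<notin> jackknife_plus \<mu> T \<alpha> (map z [0..<n]) (fst w)}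
      \<le> \<alpha> + sqrt (ln (2 / \<delta>) / (2 * real n)) + 2 * L * \<kappa>\<^sub>2 * c (n - 1)
          * (1 / \<kappa>\<^sub>1 + sqrt (real n / (2 * \<kappa>\<^sub>1\<^sup>2) * ln (2 * real CARD('p) / \<epsilon>)))"
proof -
  \<comment> \<open>Solves \<open>exp (- 2 * n * s\<^sup>2) = \<delta> / 2\<close>.\<close>
  define s where "s = sqrt (ln (2 / \<delta>) / (2 * real n))"
  define u where "u = 1 - \<alpha> - s"
  define l where "l = ln (2 * real CARD('p) / \<epsilon>)"
  \<comment> \<open>Makes the concentration bound equal to \<open>\<epsilon>\<close> when
    \<open>n\<close> stands in its exponent in place of \<open>n - 1\<close>.\<close>
  define t where "t = c (n - 1) * sqrt (real n / (2 * \<kappa>\<^sub>1\<^sup>2) * l)"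
  define F where "F = resid_cdf P \<mu> T (n - 1)"
  define A where "A = {w \<in> space P. F (mean_resid (n - 1) w) < u}"
  define N1 where "N1 = {z \<in> space (Q n).
      infnorm (T (delete_nth (n - 1) (map z [0..<n])) - mean_param P T (n - 1)) > t}"
  define N2 where "N2 = {z \<in> space (Q n). (1 - \<alpha>) * real n \<le> real (card {i. i < n \<and> z i \<in> A})}"
  have c: "c (n - 1) > 0" using c_pos n by simp
  have "ln (2 / \<delta>) > 0" using \<delta> by simp
  then have s: "s > 0" and s_sq: "2 * real n * s\<^sup>2 = ln (2 / \<delta>)"
    using n by (simp_all add: s_def)
  have "CARD('p) \<ge> 1" by (simp add: Suc_le_eq)
  then have "2 * real CARD('p) > \<epsilon>" using \<epsilon> by linarith
  then have l: "l > 0" using \<epsilon> by (simp add: l_def)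
  have t: "t > 0" using c l n \<kappa>\<^sub>1_pos by (simp add: t_def)
  have F_mono: "mono F"
    unfolding F_def mono_def resid_cdf_eq by (auto intro!: P.finite_measure_mono)
  have [measurable]: "F \<in> borel_measurable borel" by (rule borel_measurable_mono[OF F_mono])
  have A[measurable]: "A \<in> P.events" unfolding A_def by measurable
  have N1: "N1 \<in> sets (Q n)"
  proof -
    have "infnorm \<in> borel_measurable (borel :: (real ^ 'p) measure)"
      by (intro borel_measurable_continuous_onI continuous_intros)
    then have [measurable]: "(\<lambda>z. infnorm (T (delete_nth (n - 1) (map z [0..<n])) - mean_param P T (n - 1)))
        \<in> borel_measurable (Q n)"
      by (rule measurable_compose[rotated])
        (intro borel_measurable_diff loo_T_measurable, use n in auto)
    show ?thesis unfolding N1_def by measurable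
  qed
  have N2: "N2 \<in> sets (Q n)"
  proof -
    have [measurable]: "(\<lambda>z. card {i. i < n \<and> z i \<in> A}) \<in> measurable (Q n) (count_space UNIV)"
    proof (rule measurable_card)
      show "{z \<in> space (Q n). i \<in> {i. i < n \<and> z i \<in> A}} \<in> sets (Q n)" for i
        by (cases "i < n") auto
    qed
    show ?thesis unfolding N2_def by measurable
  qed
  have "Q.prob n N1 \<le> 2 * real CARD('p) * exp (- 2 * t\<^sup>2 / (real (n - 1) * (c (n - 1) / \<kappa>\<^sub>1)\<^sup>2))"
    unfolding N1_def by (rule loo_param_concentration[OF n t])
  \<comment> \<open>The true exponent is \<open>- l\<close> times \<open>n / (n - 1)\<close>, hence
    at most \<open>- l\<close>.\<close>
  also have "\<dots> \<le> 2 * real CARD('p) * exp (- l)"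
  proof -
    have "t\<^sup>2 = (c (n - 1))\<^sup>2 * (real n / (2 * \<kappa>\<^sub>1\<^sup>2) * l)"
      using l by (simp add: t_def power_mult_distrib)
    then have "- 2 * t\<^sup>2 / (real (n - 1) * (c (n - 1) / \<kappa>\<^sub>1)\<^sup>2) = - (real n / real (n - 1)) * l"
      using c \<kappa>\<^sub>1_pos n by (simp add: power_divide field_simps)
    moreover have "l \<le> real n / real (n - 1) * l"
      using l n by (simp add: field_simps)
    ultimately show ?thesis by simp
  qed
  also have "\<dots> = \<epsilon>" using \<epsilon> by (simp add: l_def exp_minus)
  finally have prob_N1: "Q.prob n N1 \<le> \<epsilon>" .
  have prob_N2: "Q.prob n N2 \<le> \<delta>"
  proof (cases "u \<ge> 0")
    case True
    have "P.prob A \<le> u"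
      unfolding A_def F_def resid_cdf_eq by (rule P.prob_cdf_less_le[OF mean_resid_measurable True])
    \<comment> \<open>Here \<open>u + s = 1 - \<alpha>\<close>, so the threshold is the one in
      \<open>N2\<close>.\<close>
    from P.prob_count_ge_le[OF A this s, of n] have "Q.prob n N2 \<le> exp (- 2 * real n * s\<^sup>2)"
      using n by (simp add: N2_def u_def mult.commute)
    also have "\<dots> = \<delta> / 2" using s_sq \<delta> by (simp add: exp_minus)
    finally show ?thesis using \<delta> by simp
  next
    \<comment> \<open>A negative level is above no value of \<open>F\<close>, so the count is 0,
      below the positive threshold.\<close>
    case False
    then have "A = {}"
      by (auto simp: A_def F_def resid_cdf_eq not_less intro: order_trans[OF _ measure_nonneg])
    moreover have "(1 - \<alpha>) * real n > 0" using \<alpha> n by simp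
    ultimately have "N2 = {}" by (auto simp: N2_def not_le)
    then show ?thesis using \<delta> by simp
  qed
  show ?thesis
  proof (rule that[of "N1 \<union> N2"])
    show "N1 \<union> N2 \<in> sets (Q n)" using N1 N2 by auto
    show "Q.prob n (N1 \<union> N2) \<le> \<epsilon> + \<delta>"
      using measure_Un_le[OF N1 N2] prob_N1 prob_N2 by linarith
    fix z assume z: "z \<in> space (Q n)" and good: "z \<notin> N1 \<union> N2"
    have "z i \<in> space P" if "i < n" for i
      using z that by (auto simp: space_PiM)
    then have eq: "{i. i < n \<and> z i \<in> A} = {i. i < n \<and> F (mean_resid (n - 1) (z i)) < u}"
      by (auto simp: A_def)
    have "P.prob {w \<in> space P. snd w \<notin> jackknife_plus \<mu> T \<alpha> (map z [0..<n]) (fst w)}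
      \<le> 1 - u + L * (2 * (\<kappa>\<^sub>2 * (c (n - 1) / \<kappa>\<^sub>1 + t)))"
    proof (rule miscoverage_le[OF n \<alpha>(2) z _ dens f])
      show "infnorm (T (delete_nth (n - 1) (map z [0..<n])) - mean_param P T (n - 1)) \<le> t"
        using z good by (simp add: N1_def)
      show "real (card {i. i < n \<and> resid_cdf P \<mu> T (n - 1) (mean_resid (n - 1) (z i)) < u})
          < (1 - \<alpha>) * real n"
        using z good eq by (simp add: N2_def F_def)
      show "u \<le> 1" using \<alpha> s by (simp add: u_def)
    qed
    also have "\<dots> = \<alpha> + s + 2 * L * \<kappa>\<^sub>2 * c (n - 1) * (1 / \<kappa>\<^sub>1 + sqrt (real n / (2 * \<kappa>\<^sub>1\<^sup>2) * l))"
      by (simp add: u_def t_def algebra_simps)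
    finally show "P.prob {w \<in> space P. snd w \<notin> jackknife_plus \<mu> T \<alpha> (map z [0..<n]) (fst w)}
      \<le> \<alpha> + sqrt (ln (2 / \<delta>) / (2 * real n)) + 2 * L * \<kappa>\<^sub>2 * c (n - 1)
          * (1 / \<kappa>\<^sub>1 + sqrt (real n / (2 * \<kappa>\<^sub>1\<^sup>2) * ln (2 * real CARD('p) / \<epsilon>)))"
      by (simp only: s_def l_def)
  qed
qed

end

section \<open>Passage from the product space to the given probability space\<close>

theorem theorem1:
  fixes SX :: "'x measure" and Y :: "real set"
    and \<mu> :: "real ^ 'p \<Rightarrow> 'x \<Rightarrow> real"
    and T :: "('x \<times> real) list \<Rightarrow> real ^ 'p"
    and c L :: "nat \<Rightarrow> real" and \<kappa>\<^sub>1 \<kappa>\<^sub>2 \<alpha> \<epsilon> \<delta> :: real and n :: nat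
    and M :: "'w measure" and P :: "('x \<times> real) measure"
    and Z :: "nat \<Rightarrow> 'w \<Rightarrow> 'x \<times> real" and Ztest :: "'w \<Rightarrow> 'x \<times> real"
  assumes Y: "Y \<in> sets borel"
    and \<mu>_measurable: "\<And>\<beta>. \<mu> \<beta> \<in> borel_measurable SX"
    and \<mu>_bounded: "\<And>\<beta>. bounded (\<mu> \<beta> ` space SX)"
    and T: "training_algorithm SX Y T"
    and n: "n \<ge> 3" and \<alpha>: "0 < \<alpha>" "\<alpha> < 1"
    and P: "prob_space P" "sets P = sets (data_space SX Y)"
    and M: "prob_space M"
    and indep: "prob_space.indep_vars M (\<lambda>_. P) (Z(n := Ztest)) {..n}"
    and Z_distr: "\<And>i. i < n \<Longrightarrow> distr M P (Z i) = P"
    and Ztest_distr: "distr M P Ztest = P"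
    and c_pos: "\<And>k. k \<ge> 1 \<Longrightarrow> c k > 0"
    and A1: "\<And>k zs i. k \<ge> 2 \<Longrightarrow> length zs = k \<Longrightarrow> set zs \<subseteq> space SX \<times> Y \<Longrightarrow> i < k \<Longrightarrow>
          sup_norm SX (\<lambda>x. \<mu> (T (delete_nth i zs)) x - \<mu> (T zs) x) \<le> c k / 2"
    and \<kappa>\<^sub>1_pos: "\<kappa>\<^sub>1 > 0"
    and A2: "\<And>\<beta> \<beta>'. \<kappa>\<^sub>1 * infnorm (\<beta> - \<beta>') \<le> sup_norm SX (\<lambda>x. \<mu> \<beta> x - \<mu> \<beta>' x)"
            "\<And>\<beta> \<beta>'. sup_norm SX (\<lambda>x. \<mu> \<beta> x - \<mu> \<beta>' x) \<le> \<kappa>\<^sub>2 * infnorm (\<beta> - \<beta>')"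
    and A3: "\<And>k. k \<ge> 1 \<Longrightarrow> \<exists>f. has_density (resid_cdf P \<mu> T k) f \<and> (\<forall>t. f t < L k)"
    and \<epsilon>: "\<epsilon> > 0" and \<delta>: "\<delta> > 0"
  shows "measure M {\<omega> \<in> space M.
           jackknife_plus_miscoverage M P \<mu> T \<alpha> n Z Ztest \<omega>
             > \<alpha> + sqrt (ln (2 / \<delta>) / (2 * real n))
                 + 2 * L (n - 1) * \<kappa>\<^sub>2 * c (n - 1)
                   * (1 / \<kappa>\<^sub>1 + sqrt (real n / (2 * \<kappa>\<^sub>1\<^sup>2) * ln (2 * real CARD('p) / \<epsilon>)))}
         \<le> \<epsilon> + \<delta>"
proof (cases "\<epsilon> + \<delta> \<ge> 1")
  \<comment> \<open>This includes every case in which a square root could have a negative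
    argument.\<close>
  case True
  interpret prob_space M by (rule M)
  show ?thesis using True prob_le_1 by (rule order_trans[rotated])
next
  case False
  interpret prob_space M by (rule M)
  interpret stable_model SX Y \<mu> T c \<kappa>\<^sub>1 \<kappa>\<^sub>2 P
    by (rule stable_model.intro) fact+
  define D where "D \<omega> = (\<lambda>i\<in>{..<n}. Z i \<omega>)" for \<omega>
  \<comment> \<open>An explicit version of the miscoverage rate, as a function of the training
    vector.\<close>
  define h where "h z = P.prob {w \<in> space P. snd w \<notin> jackknife_plus \<mu> T \<alpha> (map z [0..<n]) (fst w)}" for z
  define bound where "bound = \<alpha> + sqrt (ln (2 / \<delta>) / (2 * real n))
                 + 2 * L (n - 1) * \<kappa>\<^sub>2 * c (n - 1)
                   * (1 / \<kappa>\<^sub>1 + sqrt (real n / (2 * \<kappa>\<^sub>1\<^sup>2) * ln (2 * real CARD('p) / \<epsilon>)))"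
  define B where "B = {v \<in> space (Q n \<Otimes>\<^sub>M P).
      snd (snd v) \<notin> jackknife_plus \<mu> T \<alpha> (map (fst v) [0..<n]) (fst (snd v))}"
  have B: "B \<in> sets (Q n \<Otimes>\<^sub>M P)"
    unfolding B_def by (rule sets_miss) (use n \<alpha> in auto)
  have rv: "random_variable P ((Z(n := Ztest)) i)" if "i \<in> {..n}" for i
    using indep that by (simp add: indep_vars_def)
  have Z[measurable]: "random_variable P (Z i)" if "i < n" for i
    using rv[of i] that by simp
  have Ztest[measurable]: "random_variable P Ztest"
    using rv[of n] by simp
  have D[measurable]: "D \<in> measurable M (Q n)"
    unfolding D_def by measurable
  have all: "(\<lambda>\<omega>. \<lambda>i\<in>{..n}. (Z(n := Ztest)) i \<omega>) \<in> measurable M (\<Pi>\<^sub>M i\<in>{..n}. P)"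
    by (intro measurable_restrict rv)
  \<comment> \<open>Independence and equal laws together: training and test points, the latter at
    index \<open>n\<close>, have the product law.\<close>
  have "distr M (\<Pi>\<^sub>M i\<in>{..n}. P) (\<lambda>\<omega>. \<lambda>i\<in>{..n}. (Z(n := Ztest)) i \<omega>)
      = (\<Pi>\<^sub>M i\<in>{..n}. distr M P ((Z(n := Ztest)) i))"
    using indep_vars_iff_distr_eq_PiM'[where I = "{..n}" and M' = "\<lambda>_. P" and X = "Z(n := Ztest)"] rv indep by simp
  also have "\<dots> = (\<Pi>\<^sub>M i\<in>{..n}. P)"
    using Z_distr Ztest_distr by (intro PiM_cong) auto
  finally have joint: "distr M (\<Pi>\<^sub>M i\<in>{..n}. P) (\<lambda>\<omega>. \<lambda>i\<in>{..n}. (Z(n := Ztest)) i \<omega>) = (\<Pi>\<^sub>M i\<in>{..n}. P)" .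
  have split: "(\<lambda>z. (restrict z {..<n}, z n)) \<in> measurable (\<Pi>\<^sub>M i\<in>{..n}. P) (Q n \<Otimes>\<^sub>M P)"
    by (intro measurable_Pair measurable_restrict_subset measurable_component_singleton) auto
  have "distr M (Q n \<Otimes>\<^sub>M P) (\<lambda>\<omega>. (D \<omega>, Ztest \<omega>))
      = distr (distr M (\<Pi>\<^sub>M i\<in>{..n}. P) (\<lambda>\<omega>. \<lambda>i\<in>{..n}. (Z(n := Ztest)) i \<omega>))
          (Q n \<Otimes>\<^sub>M P) (\<lambda>z. (restrict z {..<n}, z n))"
    unfolding distr_distr[OF split all]
    by (rule distr_cong) (auto simp: D_def fun_eq_iff)
  then have pair: "distr M (Q n \<Otimes>\<^sub>M P) (\<lambda>\<omega>. (D \<omega>, Ztest \<omega>)) = Q n \<Otimes>\<^sub>M P"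
    unfolding joint distr_PiM_split_last[OF P(1)] .
  have D_distr: "distr M (Q n) D = Q n"
  proof -
    have "distr M (Q n) D = distr (distr M (Q n \<Otimes>\<^sub>M P) (\<lambda>\<omega>. (D \<omega>, Ztest \<omega>))) (Q n) fst"
      by (subst distr_distr) (auto simp: comp_def)
    also have "\<dots> = Q n"
      unfolding pair by (rule P.distr_pair_fst)
    finally show ?thesis .
  qed
  have miss_eq: "{\<omega> \<in> space M. snd (Ztest \<omega>)
        \<notin> jackknife_plus \<mu> T \<alpha> (map (\<lambda>i. Z i \<omega>) [0..<n]) (fst (Ztest \<omega>))}
      = {\<omega> \<in> space M. (D \<omega>, Ztest \<omega>) \<in> B}"
    using measurable_space[OF D] measurable_space[OF Ztest]
    by (auto simp: B_def D_def map_restrict_upt space_pair_measure)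
  have cond: "AE \<omega> in M. jackknife_plus_miscoverage M P \<mu> T \<alpha> n Z Ztest \<omega> = h (D \<omega>)"
  proof -
    have "AE \<omega> in M. cond_prob_given M (Q n) D {\<omega> \<in> space M. (D \<omega>, Ztest \<omega>) \<in> B} \<omega>
        = measure (distr M P Ztest) (Pair (D \<omega>) -` B)"
      by (rule cond_prob_given_indep[OF D Ztest _ B]) (simp add: pair D_distr Ztest_distr)
    moreover have "measure (distr M P Ztest) (Pair (D \<omega>) -` B) = h (D \<omega>)" if "\<omega> \<in> space M" for \<omega>
      unfolding Ztest_distr h_def using measurable_space[OF D that]
      by (intro arg_cong[where f = P.prob]) (auto simp: B_def space_pair_measure)
    ultimately show ?thesis
      unfolding jackknife_plus_miscoverage_def miss_eq D_def[symmetric, abs_def] by auto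
  qed
  have "n - 1 \<ge> 1" using n by simp
  from A3[OF this] obtain f where f: "has_density (resid_cdf P \<mu> T (n - 1)) f" "\<And>t. f t \<le> L (n - 1)"
    by (blast intro: less_imp_le)
  obtain N where N: "N \<in> sets (Q n)" "Q.prob n N \<le> \<epsilon> + \<delta>"
    "\<And>z. z \<in> space (Q n) \<Longrightarrow> z \<notin> N \<Longrightarrow> h z \<le> bound"
    unfolding h_def bound_def
    by (rule miscoverage_exceptional_set[OF n \<alpha> \<epsilon> _ \<delta> _ f]) (use False \<epsilon> \<delta> in auto)
  \<comment> \<open>Conditional probabilities are determined only almost everywhere, so the
    inclusion in the preimage of \<open>N\<close> holds up to a null set.\<close>
  have "prob {\<omega> \<in> space M. jackknife_plus_miscoverage M P \<mu> T \<alpha> n Z Ztest \<omega> > bound}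
      \<le> prob (D -` N \<inter> space M)"
  proof (rule finite_measure_mono_AE)
    show "AE \<omega> in M. \<omega> \<in> {\<omega> \<in> space M. jackknife_plus_miscoverage M P \<mu> T \<alpha> n Z Ztest \<omega> > bound}
        \<longrightarrow> \<omega> \<in> D -` N \<inter> space M"
      using cond
    proof eventually_elim
      case (elim \<omega>)
      then show ?case using N(3)[of "D \<omega>"] measurable_space[OF D, of \<omega>] by (auto simp: not_le[symmetric])
    qed
  qed (rule measurable_sets[OF D N(1)])
  also have "\<dots> = Q.prob n N"
    using measure_distr[OF D N(1)] by (simp add: D_distr)
  finally show ?thesis using N(2) by (simp add: bound_def)
qed

end
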